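(* Let $1<p\le 2$. There is a constant $C_p>0$ such that for every $f\in L^p(\mathrm{Conj}(\mathrm{SU}(2)))$ $$\sum_{l\in\frac12\mathbb N_0}(2l+1)^{5p-8}\,|\widehat f(l)|^p\le C_p\,\|f\|_{L^p(\mathrm{Conj}(\mathrm{SU}(2)))}^p .$$
   Context: $\mathbb N_0=\{0,1,2,\dots\}$ and $\frac12\mathbb N_0=\{0,\frac12,1,\frac32,\dots\}$. $\mathrm{Conj}(\mathrm{SU}(2))$ is the compact space of conjugacy classes $C_x$ of $\mathrm{SU}(2)$, a commutative compact hypergroup with convolution $\delta_{C_x}*\delta_{C_y}=\int\int\delta_{C_{txt^{-1}sys^{-1}}}\,dt\,ds$ (integrals over $\mathrm{SU}(2)$ with normalized Haar measure). Its Haar measure $\lambda$ is the image of the normalized Haar measure of $\mathrm{SU}(2)$ under $x\mapsto C_x$, and $L^p(\mathrm{Conj}(\mathrm{SU}(2)))=L^p(\lambda)$. It is identified with $[0,1]$, where $t\in[0,1]$ corresponds to the class of $\mathrm{diag}(e^{i\pi t},e^{-i\pi t})$. For $l\in\frac12\mathbb N_0$ let $\psi_l(t)=\frac{\sin((2l+1)\pi t)}{\sin \pi t}$ (the trace of the $(2l+1)$-dimensional irreducible representation of $\mathrm{SU}(2)$, extended continuously to $t=0,1$). The hypergroup characters are $\chi_l=(2l+1)^{-1}\psi_l$, and $\widehat f(l)=\int f\,\overline{\chi_l}\,d\lambda$. *)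

theory Defs
  imports "HOL-Analysis.Analysis" "HOL-Probability.Probability"
begin

definition SU2 :: "(complex^2^2) set" where
  "SU2 = {A. (\<chi> i j. cnj (A $ j $ i)) ** A = mat 1 \<and> det A = 1}"

text \<open>
  A Haar measure is left invariant and regular; on the compact metrizable group \<open>SU2\<close> regularity of
  a finite Borel measure is automatic.
\<close>

definition normalized_haar_SU2 :: "(complex^2^2) measure \<Rightarrow> bool" where
  "normalized_haar_SU2 M \<longleftrightarrow>
     sets M = sets (restrict_space borel SU2) \<and> prob_space M \<and>
     (\<forall>g\<in>SU2. \<forall>A\<in>sets M. emeasure M ((\<lambda>x. g ** x) ` A) = emeasure M A)"

definition haar_SU2 :: "(complex^2^2) measure" where
  "haar_SU2 = (THE M. normalized_haar_SU2 M)"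

definition conj_class :: "complex^2^2 \<Rightarrow> (complex^2^2) set" where
  "conj_class x = {s ** x ** matrix_inv s | s. s \<in> SU2}"

definition torus_elem :: "real \<Rightarrow> complex^2^2" where
  "torus_elem t =
     (\<chi> i j. if i = j then (if i = 1 then cis (pi * t) else cis (- (pi * t))) else 0)"

text \<open>
  The map \<open>t \<mapsto> conj_class (torus_elem t)\<close> is a bijection from \<open>{0..1}\<close> onto the conjugacy classes
  of \<open>SU2\<close> (a homeomorphism for the quotient topology); its inverse carries
  \<open>Conj(SU(2))\<close> to \<open>{0..1}\<close>.
\<close>

definition class_param :: "(complex^2^2) set \<Rightarrow> real" where
  "class_param = the_inv_into {0..1} (\<lambda>t. conj_class (torus_elem t))"

definition conj_haar :: "real measure" where
  "conj_haar = distr haar_SU2 (restrict_space borel {0..1}) (\<lambda>x. class_param (conj_class x))"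

definition Lp_fun :: "real \<Rightarrow> (real \<Rightarrow> complex) \<Rightarrow> bool" where
  "Lp_fun p f \<longleftrightarrow>
     f \<in> borel_measurable conj_haar \<and> integrable conj_haar (\<lambda>t. norm (f t) powr p)"

definition Lp_norm :: "real \<Rightarrow> (real \<Rightarrow> complex) \<Rightarrow> real" where
  "Lp_norm p f = (LINT t|conj_haar. norm (f t) powr p) powr (1 / p)"

definition half_nats :: "real set" where
  "half_nats = range (\<lambda>n::nat. real n / 2)"

text \<open>The \<open>Lim\<close> branch is the continuous extension to the endpoints \<open>t = 0\<close> and \<open>t = 1\<close>.\<close>

definition psi :: "real \<Rightarrow> real \<Rightarrow> real" where
  "psi l t =
     (if t \<in> {0<..<1} then sin ((2 * l + 1) * pi * t) / sin (pi * t)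
      else Lim (at t within {0<..<1}) (\<lambda>s. sin ((2 * l + 1) * pi * s) / sin (pi * s)))"

definition chi :: "real \<Rightarrow> real \<Rightarrow> complex" where
  "chi l t = complex_of_real (psi l t / (2 * l + 1))"

definition fourier :: "(real \<Rightarrow> complex) \<Rightarrow> real \<Rightarrow> complex" where
  "fourier f l = (LINT t|conj_haar. f t * cnj (chi l t))"

end

theory Submission imports Defs begin

text \<open>
  By the Weyl integration formula the functions \<open>psi l\<close> are orthonormal for the Haar measure of
  \<open>Conj(SU(2))\<close>. For \<open>n = 2l + 1\<close>, Bessel's inequality bounds the sum of \<open>n\<^sup>2 |f^(l)|\<^sup>2\<close>, which is the
  case \<open>p = 2\<close>, while \<open>|chi l| \<le> 1\<close> bounds \<open>|f^(l)|\<close> by the \<open>L\<^sup>1\<close> norm. For \<open>p < 2\<close> one interpolates by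
  hand: on each dyadic block of frequencies \<open>f\<close> is cut at a height depending on the block, and the
  resulting bounds decay geometrically.

  Orthonormality needs only the moments of \<open>Re x\<^sub>1\<^sub>1\<close> under Haar measure. Left invariance makes all
  coordinates of the unit sphere in \<open>\<real>\<^sup>4\<close> rotations of one another, which yields a two-step recursion
  for these moments; the moments of the Weyl density satisfy the same recursion.
\<close>

section \<open>Conjugacy classes of SU(2)\<close>

text \<open>\<open>haar_SU2\<close> is a definite description, so it can be used only once existence
  and uniqueness are settled. For existence, the normalized Lebesgue measure of the solid unit ball
  of \<open>\<real>^4\<close> is projected radially onto SU(2); multiplication by a group element is
  an orthogonal map in these coordinates, so no surface measure has to be built.

  Moments suffice because \<open>psi l\<close> is a polynomial in \<open>cos (pi * t)\<close>, which
  is half the trace of the class. Orthonormality is then a statement about integrals of polynomials,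
  and the full distribution of the angle never has to be identified.

  The obstacle in the inequality is that the orthonormal functions are not uniformly bounded:
  \<open>psi l\<close> attains \<open>2 * l + 1\<close>. The cut therefore has to rise with the
  frequency. For \<open>f\<close> of norm at most 1 a block starting at \<open>N\<close> contributes
  a multiple of \<open>N powr (p - 2)\<close>. The ratio \<open>2 powr (p - 2)\<close> of the
  resulting series tends to 1 as \<open>p\<close> approaches 2, which is why \<open>p = 2\<close> is
  kept apart and why the constant depends on \<open>p\<close>.\<close>

definition su2 :: "complex \<Rightarrow> complex \<Rightarrow> complex^2^2" where
  "su2 a b = vector [vector [a, b], vector [- cnj b, cnj a]]"

lemma su2_nth [simp]:
  "su2 a b $ 1 $ 1 = a" "su2 a b $ 1 $ 2 = b"
  "su2 a b $ 2 $ 1 = - cnj b" "su2 a b $ 2 $ 2 = cnj a"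
  by (simp_all add: su2_def)

lemma su2_mult: "su2 a b ** su2 c d = su2 (a * c - b * cnj d) (a * d + b * cnj c)"
  by (simp add: vec_eq_iff forall_2 matrix_matrix_mult_def sum_2 algebra_simps)

lemma su2_one: "su2 1 0 = mat 1"
  by (simp add: vec_eq_iff forall_2 mat_def)

lemma su2_in_SU2_iff: "su2 a b \<in> SU2 \<longleftrightarrow> (cmod a)\<^sup>2 + (cmod b)\<^sup>2 = 1"
proof -
  have *: "a * cnj a + b * cnj b = 1 \<longleftrightarrow> (cmod a)\<^sup>2 + (cmod b)\<^sup>2 = 1"
    by (simp flip: complex_norm_square of_real_add of_real_power)
  show ?thesis unfolding * [symmetric] SU2_def
    by (auto simp: vec_eq_iff forall_2 matrix_matrix_mult_def sum_2 mat_def det_2 algebra_simps)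
qed

text \<open>The adjoint of a unitary matrix is its inverse, and for determinant 1 the inverse is the
  adjugate; comparing entries expresses the second column through the first.\<close>

lemma SU2_cases:
  assumes "A \<in> SU2"
  obtains a b where "A = su2 a b" "(cmod a)\<^sup>2 + (cmod b)\<^sup>2 = 1"
proof -
  define a b c d where "a = A$1$1" and "b = A$1$2" and "c = A$2$1" and "d = A$2$2"
  have e: "cnj a * a + cnj c * c = 1" "cnj a * b + cnj c * d = 0" "a * d - b * c = 1"
    using assms
    by (auto simp: SU2_def vec_eq_iff forall_2 matrix_matrix_mult_def sum_2 mat_def det_2
        a_def b_def c_def d_def)
  \<comment> \<open>Multiply the first equation by \<open>d\<close> and eliminate
    \<open>a * d\<close> and \<open>cnj c * d\<close> with the other two.\<close>
  have "d = cnj a" using e by algebra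
  moreover have "b = - cnj c" using e by algebra
  ultimately have "A = su2 a b"
    by (simp add: vec_eq_iff forall_2 a_def b_def c_def d_def)
  then show thesis using that assms su2_in_SU2_iff by metis
qed

lemma su2_mult_adj:
  assumes "su2 a b \<in> SU2"
  shows "su2 a b ** su2 (cnj a) (- b) = mat 1" "su2 (cnj a) (- b) ** su2 a b = mat 1"
proof -
  have "a * cnj a + b * cnj b = 1"
    using assms by (simp add: su2_in_SU2_iff flip: complex_norm_square of_real_add of_real_power)
  then show "su2 a b ** su2 (cnj a) (- b) = mat 1" "su2 (cnj a) (- b) ** su2 a b = mat 1"
    by (simp_all add: su2_mult su2_one[symmetric] algebra_simps)
qed

lemma SU2_one: "mat 1 \<in> SU2"
  by (simp add: su2_in_SU2_iff flip: su2_one)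

lemma SU2_mult: "A \<in> SU2 \<Longrightarrow> B \<in> SU2 \<Longrightarrow> A ** B \<in> SU2"
proof -
  assume "A \<in> SU2" "B \<in> SU2"
  then have *: "(\<chi> i j. cnj (A $ j $ i)) ** A = mat 1" "(\<chi> i j. cnj (B $ j $ i)) ** B = mat 1"
    "det (A ** B) = 1"
    by (auto simp: SU2_def det_mul)
  have "(\<chi> i j. cnj ((A ** B) $ j $ i)) = (\<chi> i j. cnj (B $ j $ i)) ** (\<chi> i j. cnj (A $ j $ i))"
    by (simp add: vec_eq_iff matrix_matrix_mult_def mult.commute)
  then have "(\<chi> i j. cnj ((A ** B) $ j $ i)) ** (A ** B) =
      (\<chi> i j. cnj (B $ j $ i)) ** ((\<chi> i j. cnj (A $ j $ i)) ** A) ** B"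
    by (simp add: matrix_mul_assoc)
  then show "A ** B \<in> SU2" using * by (simp add: SU2_def)
qed

lemma SU2_inverse:
  assumes "A \<in> SU2"
  obtains B where "B \<in> SU2" "A ** B = mat 1" "B ** A = mat 1"
proof -
  obtain a b where A: "A = su2 a b" "(cmod a)\<^sup>2 + (cmod b)\<^sup>2 = 1"
    using SU2_cases[OF assms] .
  show thesis
    using that[of "su2 (cnj a) (- b)"] A su2_mult_adj assms by (simp add: su2_in_SU2_iff)
qed

lemma matrix_inv_eq:
  assumes "(A :: complex^2^2) ** B = mat 1" "B ** A = mat 1"
  shows "matrix_inv A = B"
proof -
  have "A ** matrix_inv A = mat 1"
    unfolding matrix_inv_def by (rule conjunct1, rule someI[of _ B]) (use assms in auto)
  then have "B ** (A ** matrix_inv A) = B" by simp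
  then show ?thesis using assms by (simp add: matrix_mul_assoc)
qed

lemma trace_conj_class:
  assumes "y \<in> conj_class x"
  shows "trace y = trace x"
proof -
  obtain s where s: "s \<in> SU2" "y = s ** x ** matrix_inv s"
    using assms by (auto simp: conj_class_def)
  obtain B where B: "B \<in> SU2" "s ** B = mat 1" "B ** s = mat 1"
    using SU2_inverse[OF s(1)] .
  have "trace y = trace (s ** (x ** B))"
    using s B matrix_inv_eq by (simp add: matrix_mul_assoc)
  also have "\<dots> = trace (x ** B ** s)" by (rule trace_mul_sym)
  also have "\<dots> = trace x" using B by (simp add: matrix_mul_assoc[symmetric])
  finally show ?thesis .
qed

lemma self_in_conj_class: "x \<in> conj_class x"
proof -
  have "matrix_inv (mat 1 :: complex^2^2) = mat 1" by (intro matrix_inv_eq) simp_all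
  then have "x = mat 1 ** x ** matrix_inv (mat 1)" by simp
  then show ?thesis unfolding conj_class_def using SU2_one by blast
qed

text \<open>The intertwining form \<open>x ** s = s ** y\<close> spares the caller the inverse of
  \<open>s\<close>. It is symmetric: the inverse \<open>B\<close> of \<open>s\<close> satisfies
  \<open>y ** B = B ** x\<close>, so one inclusion gives both.\<close>

lemma conj_class_cong:
  assumes "s \<in> SU2" "x ** s = s ** y"
  shows "conj_class x = conj_class y"
proof -
  have sub: "conj_class x \<subseteq> conj_class y" if s: "s \<in> SU2" "x ** s = s ** y" for s x y
  proof
    fix z assume "z \<in> conj_class x"
    then obtain r where r: "r \<in> SU2" "z = r ** x ** matrix_inv r"
      by (auto simp: conj_class_def)
    obtain B where B: "B \<in> SU2" "s ** B = mat 1" "B ** s = mat 1"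
      using SU2_inverse[OF s(1)] .
    obtain R where R: "R \<in> SU2" "r ** R = mat 1" "R ** r = mat 1"
      using SU2_inverse[OF r(1)] .
    have "r ** s ** (B ** R) = r ** (s ** B) ** R" "B ** R ** (r ** s) = B ** (R ** r) ** s"
      by (simp_all only: matrix_mul_assoc)
    then have inv: "matrix_inv (r ** s) = B ** R"
      using B R by (intro matrix_inv_eq) simp_all
    have "x = x ** (s ** B)" using B by simp
    also have "\<dots> = s ** y ** B" using s by (simp add: matrix_mul_assoc)
    finally have "z = r ** (s ** y ** B) ** R" using r R matrix_inv_eq by simp
    also have "\<dots> = (r ** s) ** y ** (B ** R)" by (simp only: matrix_mul_assoc)
    finally have "z = (r ** s) ** y ** matrix_inv (r ** s)" by (simp only: inv)
    then show "z \<in> conj_class y"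
      unfolding conj_class_def using SU2_mult[OF r(1) s(1)] by blast
  qed
  obtain B where B: "B \<in> SU2" "s ** B = mat 1" "B ** s = mat 1"
    using SU2_inverse[OF assms(1)] .
  have "y ** B = B ** (s ** y) ** B" using B by (simp add: matrix_mul_assoc)
  also have "\<dots> = B ** x ** (s ** B)" unfolding assms(2)[symmetric] by (simp add: matrix_mul_assoc)
  finally have "y ** B = B ** x" using B by simp
  then show ?thesis using sub assms B(1) by blast
qed

lemma torus_elem_eq_su2: "torus_elem t = su2 (cis (pi * t)) 0"
  by (simp add: vec_eq_iff forall_2 torus_elem_def cis_cnj)

lemma SU2_coordinates:
  assumes "A \<in> SU2"
  shows "(Re (A$1$1))\<^sup>2 + (Im (A$1$1))\<^sup>2 + (Re (A$1$2))\<^sup>2 + (Im (A$1$2))\<^sup>2 = 1"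
  using assms by (rule SU2_cases) (simp add: cmod_def)

lemma SU2_coordinates_le_1:
  assumes "A \<in> SU2"
  shows "\<bar>Re (A$1$1)\<bar> \<le> 1" "\<bar>Im (A$1$1)\<bar> \<le> 1" "\<bar>Re (A$1$2)\<bar> \<le> 1" "\<bar>Im (A$1$2)\<bar> \<le> 1"
proof -
  have "(Re (A$1$1))\<^sup>2 \<le> 1" "(Im (A$1$1))\<^sup>2 \<le> 1" "(Re (A$1$2))\<^sup>2 \<le> 1" "(Im (A$1$2))\<^sup>2 \<le> 1"
    using SU2_coordinates[OF assms] zero_le_power2[of "Re (A$1$1)"] zero_le_power2[of "Im (A$1$1)"]
      zero_le_power2[of "Re (A$1$2)"] zero_le_power2[of "Im (A$1$2)"] by linarith+
  then show "\<bar>Re (A$1$1)\<bar> \<le> 1" "\<bar>Im (A$1$1)\<bar> \<le> 1" "\<bar>Re (A$1$2)\<bar> \<le> 1" "\<bar>Im (A$1$2)\<bar> \<le> 1"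
    by (simp_all add: abs_square_le_1)
qed

text \<open>This is diagonalization inside SU(2). The characteristic polynomial has trace
  \<open>2 * Re a\<close> and determinant 1, so the eigenvalues are \<open>cis \<theta>\<close> and
  its conjugate with \<open>cos \<theta> = Re a\<close>; a unit eigenvector for
  \<open>cis \<theta>\<close> is the first column of the conjugating matrix.\<close>

lemma conj_class_SU2:
  assumes "A \<in> SU2"
  shows "conj_class A = conj_class (torus_elem (arccos (Re (A $ 1 $ 1)) / pi))"
proof -
  define \<theta> where "\<theta> = arccos (Re (A $ 1 $ 1))"
  define e where "e = cis \<theta>"
  obtain a b where A: "A = su2 a b" "(cmod a)\<^sup>2 + (cmod b)\<^sup>2 = 1"
    using SU2_cases[OF assms] .
  have c: "cos \<theta> = Re a"
    using SU2_coordinates_le_1(1)[OF assms] A(1) by (simp add: \<theta>_def cos_arccos_abs)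
  have ee: "e * cnj e = 1" by (simp add: e_def cis_cnj cis_mult)
  have ab: "a * cnj a + b * cnj b = 1"
    using A(2) by (simp flip: complex_norm_square of_real_add of_real_power)
  have tr: "e + cnj e = a + cnj a" using c by (simp add: complex_eq_iff e_def)
  have T: "torus_elem (\<theta> / pi) = su2 e 0" by (simp add: torus_elem_eq_su2 e_def)
  have "\<exists>s\<in>SU2. A ** s = s ** su2 e 0"
  proof (cases "b = 0")
    case True
    \<comment> \<open>For \<open>b = 0\<close> the matrix is diagonal, so \<open>a\<close> is itself
      an eigenvalue. If it is the wrong one, the Weyl element \<open>su2 0 1\<close> swaps the
      two.\<close>
    have "(a - e) * (a - cnj e) = 0" using ab tr ee True by algebra
    then consider "a = e" | "a = cnj e" by auto
    then show ?thesis
    proof cases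
      case 1
      then show ?thesis using A True by (intro bexI[OF _ SU2_one]) simp
    next
      case 2
      have "su2 0 1 \<in> SU2" by (simp add: su2_in_SU2_iff)
      moreover have "A ** su2 0 1 = su2 0 1 ** su2 e 0"
        using 2 A True by (simp add: su2_mult)
      ultimately show ?thesis by blast
    qed
  next
    case False
    \<comment> \<open>The vector \<open>(b, e - a)\<close> is an eigenvector for \<open>e\<close>,
      nonzero because \<open>b\<close> is; \<open>k\<close> is its length, and
      \<open>(p, - cnj q)\<close>, the first column of \<open>su2 p q\<close>, is its
      normalization.\<close>
    define k where "k = sqrt ((cmod b)\<^sup>2 + (cmod (e - a))\<^sup>2)"
    have k: "k > 0" unfolding k_def using False by (simp add: add_pos_nonneg)
    define p q where "p = b / of_real k" and "q = (cnj a - cnj e) / of_real k"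
    have "su2 p q \<in> SU2"
    proof -
      have "(cmod p)\<^sup>2 + (cmod q)\<^sup>2 = ((cmod b)\<^sup>2 + (cmod (e - a))\<^sup>2) / k\<^sup>2"
        using k by (simp add: p_def q_def norm_divide power_divide add_divide_distrib
          norm_minus_commute flip: complex_cnj_diff)
      also have "k\<^sup>2 = (cmod b)\<^sup>2 + (cmod (e - a))\<^sup>2" by (simp add: k_def)
      also have "((cmod b)\<^sup>2 + (cmod (e - a))\<^sup>2) / \<dots> = 1" using False by (simp add: add_pos_nonneg sum_power2_eq_zero_iff)
      finally show ?thesis by (simp add: su2_in_SU2_iff)
    qed
    moreover have "A ** su2 p q = su2 p q ** su2 e 0"
    proof -
      have "a * b - b * (a - e) = b * e" by (simp add: algebra_simps)
      moreover have "a * (cnj a - cnj e) + b * cnj b = (cnj a - cnj e) * cnj e"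
        using ab tr ee by algebra
      ultimately show ?thesis
        unfolding A su2_mult p_def q_def
        by (simp add: add_divide_distrib[symmetric] diff_divide_distrib[symmetric])
    qed
    ultimately show ?thesis by blast
  qed
  then show ?thesis using conj_class_cong T by (metis \<theta>_def)
qed

lemma trace_torus_elem: "trace (torus_elem t) = of_real (2 * cos (pi * t))"
  unfolding torus_elem_eq_su2 trace_def sum_2 su2_nth by (simp add: complex_eq_iff)

text \<open>The trace is constant on classes and equals \<open>2 * cos (pi * t)\<close> on the
  torus, where \<open>cos\<close> is injective on the relevant interval. Hence the parametrization
  is injective and its inverse is read off from half the trace,
  \<open>Re (A $ 1 $ 1)\<close>.\<close>

lemma class_param_conj_class:
  assumes "A \<in> SU2"
  shows "class_param (conj_class A) = arccos (Re (A $ 1 $ 1)) / pi"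
proof -
  have inj: "inj_on (\<lambda>t. conj_class (torus_elem t)) {0..1}"
  proof (rule inj_onI)
    fix s t :: real
    assume st: "s \<in> {0..1}" "t \<in> {0..1}" "conj_class (torus_elem s) = conj_class (torus_elem t)"
    have "torus_elem s \<in> conj_class (torus_elem t)"
      using self_in_conj_class st(3) by metis
    then have "trace (torus_elem s) = trace (torus_elem t)" by (rule trace_conj_class)
    then have "cos (pi * s) = cos (pi * t)" by (simp add: trace_torus_elem del: of_real_mult)
    moreover have "0 \<le> pi * s" "0 \<le> pi * t" "pi * s \<le> pi" "pi * t \<le> pi"
      using st mult_left_mono[of s 1 pi] mult_left_mono[of t 1 pi] by auto
    ultimately have "pi * s = pi * t" by (metis cos_inj_pi)
    then show "s = t" by simp
  qed
  have "arccos (Re (A $ 1 $ 1)) / pi \<in> {0..1}"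
    using SU2_coordinates_le_1(1)[OF assms] arccos_lbound[of "Re (A $ 1 $ 1)"] arccos_ubound[of "Re (A $ 1 $ 1)"]
    by (simp add: abs_le_iff)
  then show ?thesis
    unfolding class_param_def conj_class_SU2[OF assms] by (intro the_inv_into_f_f inj)
qed

section \<open>Haar measure on SU(2)\<close>

lemma space_borel_SU2 [simp]: "space (restrict_space borel SU2) = SU2"
  by (simp add: space_restrict_space)

section \<open>Rotation invariance of Lebesgue measure on the unit ball of
  \<open>\<real>^4\<close>\<close>

lemma measurable_orthogonal_transformation:
  fixes T :: "'a::euclidean_space \<Rightarrow> 'a"
  assumes "orthogonal_transformation T"
  shows "T \<in> borel_measurable borel"
  using assms by (intro borel_measurable_continuous_onI linear_continuous_on)
    (simp add: orthogonal_transformation_linear linear_linear)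

lemma emeasure_lborel_orthogonal_vimage:
  fixes T :: "real^'n::{finite,wellorder} \<Rightarrow> real^'n::_"
  assumes T: "orthogonal_transformation T" and A: "A \<in> sets borel" "bounded A"
  shows "emeasure lborel (T -` A) = emeasure lborel A"
proof -
  have lm: "A \<in> lmeasurable" using A by (simp add: bounded_set_imp_lmeasurable)
  have inv: "orthogonal_transformation (inv T)"
    using T by (rule orthogonal_transformation_inv)
  have img: "T -` A = inv T ` A"
    using orthogonal_transformation_bij[OF T] by (simp add: bij_vimage_eq_inv_image)
  have "T -` A \<in> sets borel"
    using measurable_sets[OF measurable_orthogonal_transformation[OF T] A(1)] by simp
  then have "emeasure lborel (T -` A) = emeasure lebesgue (T -` A)" by simp
  also have "\<dots> = emeasure lebesgue A"
    using measurable_orthogonal_image[OF inv lm] measure_orthogonal_image[OF inv lm] lm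
    by (simp add: img emeasure_eq_measure2)
  also have "\<dots> = emeasure lborel A" using A by simp
  finally show ?thesis .
qed

abbreviation unit_ball_measure :: "(real^4) measure" where
  "unit_ball_measure \<equiv> uniform_measure lborel (ball 0 1)"

lemma emeasure_unit_ball:
  "emeasure lborel (ball (0::real^4) 1) \<noteq> 0" "emeasure lborel (ball (0::real^4) 1) \<noteq> \<infinity>"
proof -
  show "emeasure lborel (ball (0::real^4) 1) \<noteq> 0"
    using open_not_negligible[of "ball (0::real^4) 1"]
    by (auto simp: negligible_iff_emeasure0)
  show "emeasure lborel (ball (0::real^4) 1) \<noteq> \<infinity>"
    using emeasure_bounded_finite[of "ball (0::real^4) 1"] by auto
qed

lemma distr_unit_ball_orthogonal:
  assumes T: "orthogonal_transformation T"
  shows "distr unit_ball_measure borel T = unit_ball_measure"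
proof (rule measure_eqI)
  fix A assume "A \<in> sets (distr unit_ball_measure borel T)"
  then have A [measurable]: "A \<in> sets borel" by simp
  note [measurable] = measurable_orthogonal_transformation[OF T]
  have vA: "T -` A \<in> sets borel"
    using measurable_sets[OF measurable_orthogonal_transformation[OF T] A] by simp
  have "emeasure (distr unit_ball_measure borel T) A =
      emeasure lborel (ball 0 1 \<inter> T -` A) / emeasure lborel (ball (0::real^4) 1)"
    using vA by (simp add: emeasure_distr)
  also have "ball 0 1 \<inter> T -` A = T -` (ball 0 1 \<inter> A)"
    using orthogonal_transformation_norm[OF T] by auto
  also have "emeasure lborel \<dots> = emeasure lborel (ball 0 1 \<inter> A)"
    by (intro emeasure_lborel_orthogonal_vimage T) (auto intro: bounded_Int)
  finally show "emeasure (distr unit_ball_measure borel T) A = emeasure unit_ball_measure A"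
    by simp
qed simp

section \<open>SU(2) as the unit sphere of the quaternions \<open>\<real>^4\<close>, with the
  projected ball measure\<close>

definition su2_of_vec :: "real^4 \<Rightarrow> complex^2^2" where
  "su2_of_vec v = su2 (Complex (v$1) (v$2)) (Complex (v$3) (v$4))"

definition vec_of_mat :: "complex^2^2 \<Rightarrow> real^4" where
  "vec_of_mat A = (\<chi> i. if i = 1 then Re (A$1$1) else if i = 2 then Im (A$1$1)
     else if i = 3 then Re (A$1$2) else Im (A$1$2))"

lemma vec_of_mat_nth [simp]:
  "vec_of_mat A $ 1 = Re (A$1$1)" "vec_of_mat A $ 2 = Im (A$1$1)"
  "vec_of_mat A $ 3 = Re (A$1$2)" "vec_of_mat A $ 4 = Im (A$1$2)"
  by (simp_all add: vec_of_mat_def)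

lemma su2_of_vec_of_mat_su2 [simp]: "su2_of_vec (vec_of_mat (su2 a b)) = su2 a b"
  by (simp add: su2_of_vec_def)

lemma vec_of_mat_su2_of_vec [simp]: "vec_of_mat (su2_of_vec v) = v"
  by (simp add: vec_eq_iff forall_4 su2_of_vec_def)

lemma linear_su2_of_vec: "linear su2_of_vec"
  by (rule linearI)
    (simp_all add: vec_eq_iff forall_2 su2_of_vec_def complex_eq_iff)

lemma linear_vec_of_mat: "linear vec_of_mat"
  by (rule linearI) (simp_all add: vec_eq_iff forall_4)

text \<open>This is the multiplicativity of the quaternion norm in disguise: multiplying by a matrix
  of determinant 1 preserves the Euclidean length.\<close>

lemma det_su2_of_vec: "det (su2_of_vec v) = of_real ((norm v)\<^sup>2)"
  by (simp add: su2_of_vec_def det_2 norm_vec_def L2_set_def sum_4 complex_eq_iff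
      power2_eq_square real_sqrt_mult_self flip: of_real_power)

lemma su2_of_vec_in_SU2: "norm v = 1 \<Longrightarrow> su2_of_vec v \<in> SU2"
  by (auto simp: su2_of_vec_def su2_in_SU2_iff norm_vec_def L2_set_def sum_4 cmod_def)

text \<open>The value at the origin is an arbitrary element of SU(2); it concerns a null set and
  makes the map total into the group.\<close>

definition sphere_to_SU2 :: "real^4 \<Rightarrow> complex^2^2" where
  "sphere_to_SU2 v = (if v = 0 then mat 1 else su2_of_vec (v /\<^sub>R norm v))"

lemma sphere_to_SU2_in: "sphere_to_SU2 v \<in> SU2"
  by (simp add: sphere_to_SU2_def SU2_one su2_of_vec_in_SU2)

lemma measurable_sphere_to_SU2 [measurable]:
  "sphere_to_SU2 \<in> borel \<rightarrow>\<^sub>M restrict_space borel SU2"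
proof (rule measurable_restrict_space2)
  have [measurable]: "su2_of_vec \<in> borel_measurable borel"
    using linear_su2_of_vec
    by (intro borel_measurable_continuous_onI linear_continuous_on)
      (simp add: linear_linear)
  show "sphere_to_SU2 \<in> borel_measurable borel"
    unfolding sphere_to_SU2_def by measurable
qed (simp add: sphere_to_SU2_in)

definition ball_haar :: "(complex^2^2) measure" where
  "ball_haar = distr unit_ball_measure (restrict_space borel SU2) sphere_to_SU2"

lemma sets_ball_haar [measurable_cong, simp]: "sets ball_haar = sets (restrict_space borel SU2)"
  by (simp add: ball_haar_def)

lemma prob_space_ball_haar: "prob_space ball_haar"
  unfolding ball_haar_def
  using emeasure_unit_ball by (intro prob_space.prob_space_distr prob_space_uniform_measure) auto

text \<open>Since \<open>T\<close> is linear and preserves norms, it commutes with radial projection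
  away from the origin, so invariance of the ball measure under \<open>T\<close> descends to
  invariance under \<open>F\<close>.\<close>

lemma distr_ball_haar_orthogonal:
  assumes F [measurable]: "F \<in> restrict_space borel SU2 \<rightarrow>\<^sub>M restrict_space borel SU2"
    and T: "orthogonal_transformation T"
    and FT: "\<And>v. F (su2_of_vec v) = su2_of_vec (T v)"
  shows "distr ball_haar (restrict_space borel SU2) F = ball_haar"
proof -
  note [measurable] = measurable_orthogonal_transformation[OF T]
  have "AE v in unit_ball_measure. F (sphere_to_SU2 v) = sphere_to_SU2 (T v)"
  proof (intro AE_uniform_measureI)
    show "AE v in lborel. v \<in> ball 0 1 \<longrightarrow> F (sphere_to_SU2 v) = sphere_to_SU2 (T v)"
      using AE_lborel_singleton[of 0]
    proof (rule eventually_mono)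
      fix v :: "real^4" assume v: "v \<noteq> 0"
      then have "T v \<noteq> 0" using orthogonal_transformation_norm[OF T, of v] by auto
      then show "v \<in> ball 0 1 \<longrightarrow> F (sphere_to_SU2 v) = sphere_to_SU2 (T v)"
        using v by (simp add: sphere_to_SU2_def FT orthogonal_transformation_norm[OF T]
            orthogonal_transformation_scaleR[OF T])
    qed
  qed simp
  then have "distr unit_ball_measure (restrict_space borel SU2) (F \<circ> sphere_to_SU2) =
      distr unit_ball_measure (restrict_space borel SU2) (sphere_to_SU2 \<circ> T)"
    by (intro distr_cong_AE) simp_all
  then have "distr ball_haar (restrict_space borel SU2) F =
      distr (distr unit_ball_measure borel T) (restrict_space borel SU2) sphere_to_SU2"
    unfolding ball_haar_def by (simp add: distr_distr)
  then show ?thesis by (simp add: distr_unit_ball_orthogonal[OF T] ball_haar_def)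
qed

lemma measurable_SU2_mult [measurable (raw)]:
  fixes f g :: "'a \<Rightarrow> complex^2^2"
  assumes "f \<in> M \<rightarrow>\<^sub>M restrict_space borel SU2" "g \<in> M \<rightarrow>\<^sub>M restrict_space borel SU2"
  shows "(\<lambda>x. f x ** g x) \<in> M \<rightarrow>\<^sub>M restrict_space borel SU2"
proof -
  have fg: "f \<in> space M \<rightarrow> SU2" "f \<in> borel_measurable M"
    "g \<in> space M \<rightarrow> SU2" "g \<in> borel_measurable M"
    using assms by (auto simp: measurable_restrict_space2_iff)
  have "continuous_on UNIV (\<lambda>p :: (complex^2^2) \<times> (complex^2^2). fst p ** snd p)"
    unfolding matrix_matrix_mult_def by (intro continuous_intros continuous_on_vec_lambda)
  then have "(\<lambda>x. f x ** g x) \<in> borel_measurable M"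
    using borel_measurable_continuous_Pair[OF fg(2,4)] by blast
  then show ?thesis
    using fg SU2_mult by (intro measurable_restrict_space2) auto
qed

text \<open>Both multiplications are linear, map the quaternions \<open>su2 a b\<close> to
  themselves and preserve determinants, hence are orthogonal on \<open>\<real>^4\<close>. Right
  invariance is wanted for the uniqueness argument.\<close>

lemma ball_haar_mult:
  assumes g: "g \<in> SU2"
  shows "distr ball_haar (restrict_space borel SU2) (\<lambda>x. g ** x) = ball_haar"
    and "distr ball_haar (restrict_space borel SU2) (\<lambda>x. x ** g) = ball_haar"
proof -
  obtain a b where ab: "g = su2 a b" by (rule SU2_cases[OF g])
  have gs: "g \<in> space (restrict_space borel SU2)" using g by simp
  have orth: "orthogonal_transformation (\<lambda>v. vec_of_mat (F (su2_of_vec v)))"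
    if "linear F" "\<And>v. F (su2_of_vec v) = su2_of_vec (vec_of_mat (F (su2_of_vec v)))"
      "\<And>x. det (F x) = det x" for F
    unfolding orthogonal_transformation
  proof safe
    show "linear (\<lambda>v. vec_of_mat (F (su2_of_vec v)))"
      using linear_compose[OF linear_compose[OF linear_su2_of_vec that(1)] linear_vec_of_mat]
      by (simp add: o_def)
    fix v
    have "complex_of_real ((norm (vec_of_mat (F (su2_of_vec v))))\<^sup>2) = of_real ((norm v)\<^sup>2)"
      unfolding det_su2_of_vec[symmetric] that(2)[symmetric] that(3) ..
    then show "norm (vec_of_mat (F (su2_of_vec v))) = norm v"
      unfolding of_real_eq_iff by (simp add: power2_eq_iff_nonneg)
  qed
  have dg: "det g = 1" using g by (simp add: SU2_def)
  have lin: "linear (\<lambda>x. g ** x)" "linear (\<lambda>x. x ** g)"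
    by (auto intro!: linearI simp: vec_eq_iff forall_2 matrix_matrix_mult_def sum_2 algebra_simps)
  have s1: "g ** su2_of_vec v = su2_of_vec (vec_of_mat (g ** su2_of_vec v))" for v
    by (subst (1 2) su2_of_vec_def) (simp add: ab su2_mult)
  have s2: "su2_of_vec v ** g = su2_of_vec (vec_of_mat (su2_of_vec v ** g))" for v
    by (subst (1 3) su2_of_vec_def) (simp add: ab su2_mult)
  show "distr ball_haar (restrict_space borel SU2) (\<lambda>x. g ** x) = ball_haar"
    using gs by (intro distr_ball_haar_orthogonal[OF _ orth[OF lin(1)]] s1)
      (auto simp: det_mul dg)
  show "distr ball_haar (restrict_space borel SU2) (\<lambda>x. x ** g) = ball_haar"
    using gs by (intro distr_ball_haar_orthogonal[OF _ orth[OF lin(2)]] s2)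
      (auto simp: det_mul dg)
qed

text \<open>The image of a set under \<open>h\<close> is its preimage under the inverse
  \<open>g\<close>, and quantifying over the whole group absorbs the inversion. The pushforward form
  is the one that feeds changes of variables.\<close>

lemma normalized_haar_SU2_iff:
  "normalized_haar_SU2 M \<longleftrightarrow> sets M = sets (restrict_space borel SU2) \<and> prob_space M \<and>
     (\<forall>g\<in>SU2. distr M (restrict_space borel SU2) (\<lambda>x. g ** x) = M)"
proof -
  have "(\<forall>A\<in>sets M. \<forall>g\<in>SU2. emeasure M ((\<lambda>x. g ** x) ` A) = emeasure M A) \<longleftrightarrow>
      (\<forall>g\<in>SU2. distr M (restrict_space borel SU2) (\<lambda>x. g ** x) = M)"
    if s [measurable_cong]: "sets M = sets (restrict_space borel SU2)"
  proof -
    have sp: "space M = SU2" using sets_eq_imp_space_eq[OF s] by simp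
    have meas: "(\<lambda>x. g ** x) \<in> M \<rightarrow>\<^sub>M restrict_space borel SU2" if "g \<in> SU2" for g
      using that measurable_ident_sets[OF s] by (intro measurable_SU2_mult) auto
    have img: "(\<lambda>x. h ** x) ` A = (\<lambda>x. g ** x) -` A \<inter> SU2"
      if "g \<in> SU2" "h \<in> SU2" "g ** h = mat 1" "h ** g = mat 1" "A \<subseteq> SU2" for g h A
    proof (intro equalityI subsetI)
      fix y assume "y \<in> (\<lambda>x. h ** x) ` A"
      then obtain x where "x \<in> A" "y = h ** x" by blast
      then show "y \<in> (\<lambda>x. g ** x) -` A \<inter> SU2"
        using that SU2_mult by (auto simp: matrix_mul_assoc)
    next
      fix x assume "x \<in> (\<lambda>x. g ** x) -` A \<inter> SU2"
      moreover have "x = h ** (g ** x)" using that by (simp add: matrix_mul_assoc)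
      ultimately show "x \<in> (\<lambda>x. h ** x) ` A" by blast
    qed
    have sub: "A \<subseteq> SU2" if "A \<in> sets M" for A using sets.sets_into_space[OF that] sp by simp
    have em: "emeasure (distr M (restrict_space borel SU2) (\<lambda>x. g ** x)) A =
        emeasure M ((\<lambda>x. h ** x) ` A)"
      if "g \<in> SU2" "h \<in> SU2" "g ** h = mat 1" "h ** g = mat 1" "A \<in> sets M" for g h A
      using that meas[OF that(1)] by (simp add: emeasure_distr img sub sp s[symmetric])
    show ?thesis
    proof safe
      fix g assume g: "g \<in> SU2" and
        *: "\<forall>A\<in>sets M. \<forall>g\<in>SU2. emeasure M ((\<lambda>x. g ** x) ` A) = emeasure M A"
      obtain h where "h \<in> SU2" "g ** h = mat 1" "h ** g = mat 1" by (rule SU2_inverse[OF g])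
      then show "distr M (restrict_space borel SU2) (\<lambda>x. g ** x) = M"
        using g * em by (intro measure_eqI) (auto simp: s)
    next
      fix g A assume g: "g \<in> SU2" "A \<in> sets M" and
        *: "\<forall>g\<in>SU2. distr M (restrict_space borel SU2) (\<lambda>x. g ** x) = M"
      obtain h where "h \<in> SU2" "g ** h = mat 1" "h ** g = mat 1" by (rule SU2_inverse[OF g(1)])
      then show "emeasure M ((\<lambda>x. g ** x) ` A) = emeasure M A"
        using g * em[of h g A] by simp
    qed
  qed
  then show ?thesis unfolding normalized_haar_SU2_def by blast
qed

text \<open>
  \<open>ball_haar\<close> is also right invariant, so convolving it with any left invariant \<open>M\<close> gives both
  \<open>M\<close> and \<open>ball_haar\<close>.
\<close>

lemma normalized_haar_SU2_unique:
  assumes "normalized_haar_SU2 M"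
  shows "M = ball_haar"
proof (rule measure_eqI)
  note * = assms[unfolded normalized_haar_SU2_iff]
  then have s [measurable_cong]: "sets M = sets (restrict_space borel SU2)" by blast
  then show "sets M = sets ball_haar" by simp
  interpret M: prob_space M using * by blast
  interpret H: prob_space ball_haar by (rule prob_space_ball_haar)
  interpret P: pair_prob_space ball_haar M ..
  have sp: "space M = SU2" "space ball_haar = SU2"
    using sets_eq_imp_space_eq[OF s] sets_eq_imp_space_eq[OF sets_ball_haar] by simp_all
  fix A assume "A \<in> sets M"
  then have A [measurable]: "A \<in> sets (restrict_space borel SU2)" using s by simp
  define k :: "complex^2^2 \<Rightarrow> ennreal" where "k = indicator A"
  have [measurable]: "k \<in> borel_measurable (restrict_space borel SU2)" by (simp add: k_def)
  have L: "(\<integral>\<^sup>+ y. k (x ** y) \<partial>M) = emeasure M A" if "x \<in> SU2" for x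
  proof -
    have "emeasure M A = (\<integral>\<^sup>+ y. k y \<partial>distr M (restrict_space borel SU2) (\<lambda>y. x ** y))"
      using * that \<open>A \<in> sets M\<close> by (simp add: k_def)
    also have "\<dots> = (\<integral>\<^sup>+ y. k (x ** y) \<partial>M)"
      using that by (subst nn_integral_distr) auto
    finally show ?thesis ..
  qed
  have R: "(\<integral>\<^sup>+ x. k (x ** y) \<partial>ball_haar) = emeasure ball_haar A" if "y \<in> SU2" for y
  proof -
    have "emeasure ball_haar A =
        (\<integral>\<^sup>+ x. k x \<partial>distr ball_haar (restrict_space borel SU2) (\<lambda>x. x ** y))"
      using that A by (simp add: ball_haar_mult k_def)
    also have "\<dots> = (\<integral>\<^sup>+ x. k (x ** y) \<partial>ball_haar)"
      using that by (subst nn_integral_distr) auto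
    finally show ?thesis ..
  qed
  have "emeasure M A = (\<integral>\<^sup>+ x. (\<integral>\<^sup>+ y. k (x ** y) \<partial>M) \<partial>ball_haar)"
    by (subst nn_integral_cong[OF L]) (simp_all add: sp H.emeasure_space_1 flip: sp(2))
  also have "\<dots> = (\<integral>\<^sup>+ y. (\<integral>\<^sup>+ x. k (x ** y) \<partial>ball_haar) \<partial>M)"
    by (rule P.Fubini'[symmetric]) measurable
  also have "\<dots> = emeasure ball_haar A"
    by (subst nn_integral_cong[OF R]) (simp_all add: sp M.emeasure_space_1 flip: sp(1))
  finally show "emeasure M A = emeasure ball_haar A" .
qed

lemma normalized_haar_SU2_haar_SU2: "normalized_haar_SU2 haar_SU2"
proof -
  have "normalized_haar_SU2 ball_haar"
    by (simp add: normalized_haar_SU2_iff prob_space_ball_haar ball_haar_mult)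
  then show ?thesis
    unfolding haar_SU2_def by (rule theI) (rule normalized_haar_SU2_unique)
qed

section \<open>Moments of the trace\<close>

lemma sets_haar_SU2 [measurable_cong, simp]: "sets haar_SU2 = sets (restrict_space borel SU2)"
  using normalized_haar_SU2_haar_SU2 by (simp add: normalized_haar_SU2_iff)

lemma space_haar_SU2 [simp]: "space haar_SU2 = SU2"
  using sets_eq_imp_space_eq[OF sets_haar_SU2] by simp

interpretation haar: prob_space haar_SU2
  using normalized_haar_SU2_haar_SU2 by (simp add: normalized_haar_SU2_iff)

lemma integral_haar_SU2_mult:
  fixes f :: "complex^2^2 \<Rightarrow> 'a::{banach, second_countable_topology}"
  assumes g: "g \<in> SU2" and f [measurable]: "f \<in> borel_measurable (restrict_space borel SU2)"
  shows "(LINT x|haar_SU2. f (g ** x)) = (LINT x|haar_SU2. f x)"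
proof -
  have m: "(\<lambda>x. g ** x) \<in> haar_SU2 \<rightarrow>\<^sub>M restrict_space borel SU2"
    using g measurable_ident_sets[OF sets_haar_SU2] by (intro measurable_SU2_mult) auto
  have "(LINT x|haar_SU2. f x) = (LINT x|distr haar_SU2 (restrict_space borel SU2) (\<lambda>x. g ** x). f x)"
    using normalized_haar_SU2_haar_SU2 g by (simp add: normalized_haar_SU2_iff)
  also have "\<dots> = (LINT x|haar_SU2. f (g ** x))"
    by (rule integral_distr[OF m f])
  finally show ?thesis ..
qed

lemma measurable_coordinate [measurable]:
  "(\<lambda>A :: complex^2^2. A $ i $ j) \<in> borel_measurable (restrict_space borel SU2)"
  by (intro borel_measurable_continuous_on_restrict continuous_intros)

lemma integrable_haar_SU2_monomial:
  fixes f g :: "complex^2^2 \<Rightarrow> real"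
  assumes [measurable]: "f \<in> borel_measurable (restrict_space borel SU2)"
      "g \<in> borel_measurable (restrict_space borel SU2)"
    and "\<And>A. A \<in> SU2 \<Longrightarrow> \<bar>f A\<bar> \<le> 1" "\<And>A. A \<in> SU2 \<Longrightarrow> \<bar>g A\<bar> \<le> 1"
  shows "integrable haar_SU2 (\<lambda>A. f A ^ m * g A ^ n)"
proof (rule haar.integrable_const_bound[of _ 1])
  show "AE A in haar_SU2. norm (f A ^ m * g A ^ n) \<le> 1"
    using assms by (auto simp: abs_mult power_abs power_le_one mult_le_one)
qed measurable

definition haar_moment :: "nat \<Rightarrow> real" where
  "haar_moment k = (LINT A|haar_SU2. Re (A$1$1) ^ k)"

lemma coeff_2_one_plus_square_power: "coeff ([:1, 0, 1:] ^ j) 2 = (of_nat j :: real)"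
proof -
  have "coeff ([:1, 0, 1 :: real:] ^ j) 0 = 1 \<and> coeff ([:1, 0, 1 :: real:] ^ j) 2 = of_nat j"
    by (induction j) (auto simp: mult_pCons_left numeral_2_eq_2 coeff_pCons)
  then show ?thesis by blast
qed

text \<open>
  The direction \<open>x\<^sub>1 - s y\<close> is a rotation of \<open>x\<^sub>1\<close> scaled by \<open>sqrt (1 + s\<^sup>2)\<close>; comparing coefficients
  of \<open>s\<^sup>2\<close> in the moments of order \<open>2 * j\<close> gives the identity.
\<close>

lemma haar_moment_coordinate:
  fixes y :: "complex^2^2 \<Rightarrow> real"
  assumes y [measurable]: "y \<in> borel_measurable (restrict_space borel SU2)"
    and y1: "\<And>A. A \<in> SU2 \<Longrightarrow> \<bar>y A\<bar> \<le> 1"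
    and rot: "\<And>s. \<exists>g\<in>SU2. \<forall>A\<in>SU2.
        Re ((g ** A)$1$1) = (Re (A$1$1) - s * y A) / sqrt (1 + s\<^sup>2)"
    and j: "j > 0"
  shows "(2 * real j - 1) * (LINT A|haar_SU2. Re (A$1$1) ^ (2 * j - 2) * (y A)\<^sup>2) = haar_moment (2 * j)"
proof -
  let ?x = "\<lambda>A :: complex^2^2. Re (A$1$1)"
  \<comment> \<open>By the binomial theorem \<open>P\<close> is the polynomial in \<open>s\<close>
    whose value is the integral of \<open>(?x A - s * y A) ^ (2 * j)\<close>.\<close>
  define P :: "real poly" where "P = (\<Sum>i\<le>2*j. monom (real (2 * j choose i) * (-1) ^ i *
      (LINT A|haar_SU2. ?x A ^ (2 * j - i) * y A ^ i)) i)"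
  have int: "integrable haar_SU2 (\<lambda>A. ?x A ^ m * y A ^ n)" for m n
    using y1 SU2_coordinates_le_1 by (intro integrable_haar_SU2_monomial) auto
  have "poly P s = poly (smult (haar_moment (2 * j)) ([:1, 0, 1:] ^ j)) s" for s
  proof -
    define r where "r = sqrt (1 + s\<^sup>2)"
    have r: "r > 0" "r\<^sup>2 = 1 + s\<^sup>2" by (simp_all add: r_def add_pos_nonneg)
    obtain g where g: "g \<in> SU2" "\<And>A. A \<in> SU2 \<Longrightarrow> ?x (g ** A) = (?x A - s * y A) / r"
      using rot[of s] r_def by blast
    have "poly P s = (\<Sum>i\<le>2*j. (real (2 * j choose i) * (-1) ^ i * s ^ i) *
        (LINT A|haar_SU2. ?x A ^ (2 * j - i) * y A ^ i))"
      by (simp only: P_def poly_sum poly_monom mult_ac)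
    also have "\<dots> = (\<Sum>i\<le>2*j. (LINT A|haar_SU2.
        real (2 * j choose i) * (-1) ^ i * s ^ i * (?x A ^ (2 * j - i) * y A ^ i)))"
      by (simp only: integral_mult_right_zero)
    also have "\<dots> = (LINT A|haar_SU2. (\<Sum>i\<le>2*j.
        real (2 * j choose i) * (-1) ^ i * s ^ i * (?x A ^ (2 * j - i) * y A ^ i)))"
      using int by (subst Bochner_Integration.integral_sum) auto
    also have "\<dots> = (LINT A|haar_SU2. (?x A - s * y A) ^ (2 * j))"
    proof (intro Bochner_Integration.integral_cong refl)
      fix A
      have "(?x A - s * y A) ^ (2 * j) = ((- 1 * s * y A) + ?x A) ^ (2 * j)" by simp
      also have "\<dots> = (\<Sum>i\<le>2*j. real (2 * j choose i) * (- 1 * s * y A) ^ i * ?x A ^ (2 * j - i))"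
        by (rule binomial_ring)
      finally show "(\<Sum>i\<le>2*j. real (2 * j choose i) * (-1) ^ i * s ^ i *
          (?x A ^ (2 * j - i) * y A ^ i)) = (?x A - s * y A) ^ (2 * j)"
        by (simp only: power_mult_distrib mult_ac)
    qed
    also have "\<dots> = (LINT A|haar_SU2. r ^ (2 * j) * ?x (g ** A) ^ (2 * j))"
      using r g by (intro Bochner_Integration.integral_cong) (auto simp: power_divide)
    also have "\<dots> = r ^ (2 * j) * haar_moment (2 * j)"
      unfolding haar_moment_def
      using integral_haar_SU2_mult[OF g(1), of "\<lambda>A. ?x A ^ (2 * j)"] by simp
    \<comment> \<open>The even order removes the square root, so both sides are polynomials in
      \<open>s\<close>.\<close>
    also have "r ^ (2 * j) = (1 + s\<^sup>2) ^ j" by (simp only: power_mult r)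
    finally show ?thesis by (simp add: poly_power power2_eq_square)
  qed
  then have "coeff P 2 = coeff (smult (haar_moment (2 * j)) ([:1, 0, 1:] ^ j)) 2"
    by (metis poly_eq_poly_eq_iff ext)
  moreover have "coeff P 2 = real (2 * j choose 2) * (LINT A|haar_SU2. ?x A ^ (2 * j - 2) * (y A)\<^sup>2)"
    using j by (auto simp: P_def coeff_sum if_distrib[of "\<lambda>f. f _"] sum.delta cong: if_cong)
  moreover have "2 * j choose 2 = j * (2 * j - 1)"
    by (simp add: choose_two mult.assoc)
  then have "real (2 * j choose 2) = real j * (2 * real j - 1)"
    using j by (simp add: of_nat_diff)
  ultimately show ?thesis using j by (simp add: coeff_2_one_plus_square_power)
qed

text \<open>Adding the identity for the three remaining coordinates and replacing the sum of their
  squares by \<open>1 - (?x A)\<^sup>2\<close> leaves only moments of \<open>?x\<close>: with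
  \<open>k + 2 = 2 * j\<close>, \<open>2 * j - 1\<close> times the difference of the two moments is
  three times the higher one.\<close>

lemma haar_moment_rec: "(real k + 4) * haar_moment (k + 2) = (real k + 1) * haar_moment k" if "even k"
proof -
  obtain i where "k = 2 * i" using \<open>even k\<close> by (elim evenE)
  then obtain j where j: "k + 2 = 2 * j" "j > 0" using that[of "i + 1"] by simp
  have k: "k = 2 * j - 2" using j by simp
  let ?x = "\<lambda>A :: complex^2^2. Re (A$1$1)"
  let ?I = "\<lambda>y. LINT A|haar_SU2. ?x A ^ (2 * j - 2) * (y A)\<^sup>2"
  let ?ys = "[\<lambda>A :: complex^2^2. Im (A$1$1), \<lambda>A. Re (A$1$2), \<lambda>A. Im (A$1$2)]"
  have c: "(1 / sqrt (1 + s\<^sup>2))\<^sup>2 + (s / sqrt (1 + s\<^sup>2))\<^sup>2 = 1" for s :: real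
    by (simp add: power_divide add_nonneg_eq_0_iff flip: add_divide_distrib)
  \<comment> \<open>The witness is the unit quaternion proportional to \<open>1 + s * u\<close>,
    with \<open>u\<close> the imaginary unit belonging to the coordinate in question; the next two
    cases use the other two imaginary units.\<close>
  have "\<exists>g\<in>SU2. \<forall>A\<in>SU2. Re ((g ** A)$1$1) = (?x A - s * Im (A$1$1)) / sqrt (1 + s\<^sup>2)" for s
    using c[of s]
    by (intro bexI[of _ "su2 (Complex (1 / sqrt (1 + s\<^sup>2)) (s / sqrt (1 + s\<^sup>2))) 0"] ballI)
      (auto simp: su2_in_SU2_iff cmod_def su2_mult power_divide diff_divide_distrib elim!: SU2_cases)
  then have 1: "(2 * real j - 1) * ?I (\<lambda>A. Im (A$1$1)) = haar_moment (2 * j)"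
    using j SU2_coordinates_le_1 by (intro haar_moment_coordinate) auto
  have "\<exists>g\<in>SU2. \<forall>A\<in>SU2. Re ((g ** A)$1$1) = (?x A - s * Re (A$1$2)) / sqrt (1 + s\<^sup>2)" for s
    using c[of s]
    by (intro bexI[of _ "su2 (Complex (1 / sqrt (1 + s\<^sup>2)) 0) (Complex (s / sqrt (1 + s\<^sup>2)) 0)"] ballI)
      (auto simp: su2_in_SU2_iff cmod_def su2_mult power_divide diff_divide_distrib elim!: SU2_cases)
  then have 2: "(2 * real j - 1) * ?I (\<lambda>A. Re (A$1$2)) = haar_moment (2 * j)"
    using j SU2_coordinates_le_1 by (intro haar_moment_coordinate) auto
  have "\<exists>g\<in>SU2. \<forall>A\<in>SU2. Re ((g ** A)$1$1) = (?x A - s * Im (A$1$2)) / sqrt (1 + s\<^sup>2)" for s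
    using c[of s]
    by (intro bexI[of _ "su2 (Complex (1 / sqrt (1 + s\<^sup>2)) 0) (Complex 0 (s / sqrt (1 + s\<^sup>2)))"] ballI)
      (auto simp: su2_in_SU2_iff cmod_def su2_mult power_divide diff_divide_distrib elim!: SU2_cases)
  then have 3: "(2 * real j - 1) * ?I (\<lambda>A. Im (A$1$2)) = haar_moment (2 * j)"
    using j SU2_coordinates_le_1 by (intro haar_moment_coordinate) auto
  have int: "integrable haar_SU2 (\<lambda>A. ?x A ^ m * y A ^ n)" if "y \<in> set ?ys" for y m n
    using that SU2_coordinates_le_1 by (intro integrable_haar_SU2_monomial) auto
  have int1: "integrable haar_SU2 (\<lambda>A. ?x A ^ m)" for m
    using int[of "\<lambda>A. Im (A$1$1)" m 0] by simp
  have "?I (\<lambda>A. Im (A$1$1)) + ?I (\<lambda>A. Re (A$1$2)) + ?I (\<lambda>A. Im (A$1$2)) =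
      (LINT A|haar_SU2. ?x A ^ (2 * j - 2) * (Im (A$1$1))\<^sup>2 + ?x A ^ (2 * j - 2) * (Re (A$1$2))\<^sup>2
        + ?x A ^ (2 * j - 2) * (Im (A$1$2))\<^sup>2)"
    using int by (simp add: Bochner_Integration.integral_add)
  also have "\<dots> = (LINT A|haar_SU2. ?x A ^ k - ?x A ^ (k + 2))"
  proof (intro Bochner_Integration.integral_cong refl)
    fix A assume "A \<in> space haar_SU2"
    then have "(Im (A$1$1))\<^sup>2 + (Re (A$1$2))\<^sup>2 + (Im (A$1$2))\<^sup>2 = 1 - (?x A)\<^sup>2"
      using SU2_coordinates[of A] by simp
    then have "?x A ^ k * (Im (A$1$1))\<^sup>2 + ?x A ^ k * (Re (A$1$2))\<^sup>2 + ?x A ^ k * (Im (A$1$2))\<^sup>2 =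
        ?x A ^ k * (1 - (?x A)\<^sup>2)"
      by (simp flip: distrib_left)
    then show "?x A ^ (2 * j - 2) * (Im (A$1$1))\<^sup>2 + ?x A ^ (2 * j - 2) * (Re (A$1$2))\<^sup>2
        + ?x A ^ (2 * j - 2) * (Im (A$1$2))\<^sup>2 = ?x A ^ k - ?x A ^ (k + 2)"
      unfolding k[symmetric] by (simp add: algebra_simps power_add power2_eq_square)
  qed
  also have "\<dots> = haar_moment k - haar_moment (k + 2)"
    unfolding haar_moment_def by (rule Bochner_Integration.integral_diff[OF int1 int1])
  finally have "haar_moment k - haar_moment (k + 2) = ?I (\<lambda>A. Im (A$1$1)) +
      ?I (\<lambda>A. Re (A$1$2)) + ?I (\<lambda>A. Im (A$1$2))" ..
  then have "(2 * real j - 1) * (haar_moment k - haar_moment (k + 2)) =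
      (2 * real j - 1) * ?I (\<lambda>A. Im (A$1$1)) + (2 * real j - 1) * ?I (\<lambda>A. Re (A$1$2))
        + (2 * real j - 1) * ?I (\<lambda>A. Im (A$1$2))"
    by (simp only: distrib_left)
  also have "\<dots> = 3 * haar_moment (k + 2)" unfolding 1 2 3 j(1) by simp
  finally have "(2 * real j - 1) * (haar_moment k - haar_moment (k + 2)) = 3 * haar_moment (k + 2)" .
  moreover have "2 * real j = real k + 2" using j(1) by linarith
  ultimately have "(real k + 2 - 1) * (haar_moment k - haar_moment (k + 2)) = 3 * haar_moment (k + 2)"
    by (simp only:)
  then show ?thesis by (simp add: algebra_simps)
qed

text \<open>Minus the identity lies in SU(2), and multiplying by it changes the sign of every odd
  power.\<close>

lemma haar_moment_odd: "haar_moment k = 0" if "odd k"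
proof -
  have "su2 (- 1) 0 \<in> SU2" by (simp add: su2_in_SU2_iff)
  then have "haar_moment k = (LINT A|haar_SU2. Re ((su2 (- 1) 0 ** A)$1$1) ^ k)"
    unfolding haar_moment_def by (intro integral_haar_SU2_mult[symmetric]) auto
  also have "\<dots> = (LINT A|haar_SU2. - (Re (A$1$1) ^ k))"
    using that
    by (intro Bochner_Integration.integral_cong)
      (auto simp: su2_def matrix_matrix_mult_def sum_2 power_minus_odd)
  also have "\<dots> = - haar_moment k" by (simp add: haar_moment_def)
  finally show ?thesis by simp
qed

section \<open>Moments of \<open>cos x\<close> under the Weyl density
  \<open>2 / pi * (sin x)\<^sup>2\<close> on \<open>{0..pi}\<close>\<close>

definition angle_moment :: "nat \<Rightarrow> real" where
  "angle_moment k = 2 / pi * integral {0..pi} (\<lambda>x. cos x ^ k * (sin x)\<^sup>2)"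

text \<open>The difference of the two integrands is the derivative of
  \<open>cos x ^ (k + 1) * sin x ^ 3\<close>, which vanishes at both ends.\<close>

lemma angle_moment_rec: "(real k + 4) * angle_moment (k + 2) = (real k + 1) * angle_moment k"
proof -
  let ?f = "\<lambda>k x. cos x ^ k * (sin x)\<^sup>2 :: real"
  have int: "?f k integrable_on {0..pi}" for k
    by (intro integrable_continuous_interval continuous_intros)
  have "((\<lambda>x. (real k + 4) * ?f (k + 2) x - (real k + 1) * ?f k x) has_integral
      (cos pi ^ (k + 1) * sin pi ^ 3 - cos 0 ^ (k + 1) * sin 0 ^ 3)) {0..pi}"
  proof (intro fundamental_theorem_of_calculus)
    fix x :: real
    have s: "sin x * sin x = 1 - cos x * cos x"
      using sin_squared_eq[of x] by (simp add: power2_eq_square)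
    have s': "sin x * (sin x * z) = z - cos x * (cos x * z)" for z
      unfolding mult.assoc[symmetric] s by (simp add: algebra_simps)
    have "((\<lambda>x. cos x ^ (k + 1) * sin x ^ 3) has_real_derivative
        (real k + 4) * ?f (k + 2) x - (real k + 1) * ?f k x) (at x within {0..pi})"
      by (rule derivative_eq_intros refl)+
        (simp add: s s' power2_eq_square power3_eq_cube algebra_simps)
    then show "((\<lambda>x. cos x ^ (k + 1) * sin x ^ 3) has_vector_derivative
        (real k + 4) * ?f (k + 2) x - (real k + 1) * ?f k x) (at x within {0..pi})"
      by (simp add: has_real_derivative_iff_has_vector_derivative)
  qed simp
  then have "integral {0..pi} (\<lambda>x. (real k + 4) * ?f (k + 2) x - (real k + 1) * ?f k x) = 0"
    by (simp add: integral_unique)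
  then have "(real k + 4) * integral {0..pi} (?f (k + 2)) - (real k + 1) * integral {0..pi} (?f k) = 0"
    using int[of k] int[of "k + 2"]
    by (subst (asm) Henstock_Kurzweil_Integration.integral_diff)
      (auto intro: integrable_on_mult_right)
  then show ?thesis by (simp add: angle_moment_def field_simps)
qed

lemma integral_sin_mult_sin:
  assumes "m > 0" "n > 0"
  shows "integral {0..pi} (\<lambda>x. sin (real m * x) * sin (real n * x)) = (if m = n then pi / 2 else 0)"
proof -
  have cos_int: "((\<lambda>x. cos (of_int k * x)) has_integral (if k = 0 then pi else 0)) {0..pi}" for k
  proof (cases "k = 0")
    case True
    then show ?thesis using has_integral_const_real[of "1::real" 0 pi] by simp
  next
    case False
    have "((\<lambda>x. cos (of_int k * x)) has_integral
        (sin (of_int k * pi) / of_int k - sin (of_int k * 0) / of_int k)) {0..pi}"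
    proof (intro fundamental_theorem_of_calculus)
      fix x :: real
      have "((\<lambda>x. sin (of_int k * x) / of_int k) has_real_derivative cos (of_int k * x))
          (at x within {0..pi})"
        using False by (auto intro!: derivative_eq_intros)
      then show "((\<lambda>x. sin (of_int k * x) / of_int k) has_vector_derivative cos (of_int k * x))
          (at x within {0..pi})"
        by (simp add: has_real_derivative_iff_has_vector_derivative)
    qed simp
    then show ?thesis using False sin_npi_int[of k] by (simp add: mult.commute)
  qed
  have "((\<lambda>x. (cos (of_int (int m - int n) * x) - cos (of_int (int m + int n) * x)) / 2) has_integral
      ((if int m - int n = 0 then pi else 0) - (if int m + int n = 0 then pi else 0)) / 2) {0..pi}"
    by (intro has_integral_divide has_integral_diff cos_int)
  moreover have "(\<lambda>x. sin (real m * x) * sin (real n * x)) =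
      (\<lambda>x. (cos (of_int (int m - int n) * x) - cos (of_int (int m + int n) * x)) / 2)"
    by (simp add: fun_eq_iff sin_times_sin algebra_simps)
  ultimately have "((\<lambda>x. sin (real m * x) * sin (real n * x)) has_integral
      ((if int m - int n = 0 then pi else 0) - (if int m + int n = 0 then pi else 0)) / 2) {0..pi}"
    by (simp only:)
  then show ?thesis using assms by (auto dest: integral_unique)
qed

text \<open>Both sequences start with 1 and 0 and obey the same two-step recursion; for odd
  \<open>k\<close> the Haar side satisfies it trivially.\<close>

lemma haar_moment_eq: "haar_moment k = angle_moment k"
proof -
  have "angle_moment 0 = 1"
    using integral_sin_mult_sin[of 1 1] by (simp add: angle_moment_def power2_eq_square)
  moreover have "haar_moment 0 = 1" using haar.prob_space by (simp add: haar_moment_def)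
  moreover have "angle_moment 1 = 0"
  proof -
    have "2 * (cos x ^ 1 * (sin x)\<^sup>2) = sin (real 2 * x) * sin (real 1 * x)" for x
      using sin_double[of x] by (simp add: power2_eq_square)
    then have "integral {0..pi} (\<lambda>x. 2 * (cos x ^ 1 * (sin x)\<^sup>2)) =
        integral {0..pi} (\<lambda>x. sin (real 2 * x) * sin (real 1 * x))"
      by (simp only:)
    also have "\<dots> = 0" by (subst integral_sin_mult_sin) auto
    finally show ?thesis by (simp only: angle_moment_def integral_mult_right) simp
  qed
  moreover have "(real k + 4) * haar_moment (k + 2) = (real k + 1) * haar_moment k" for k
    using haar_moment_rec haar_moment_odd[of k] haar_moment_odd[of "k + 2"] by (cases "even k") auto
  moreover have "real k + 4 \<noteq> 0" for k by linarith
  ultimately show ?thesis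
  proof (induction k rule: induct_nat_012)
    case (ge2 n)
    then have "(real n + 4) * haar_moment (n + 2) = (real n + 4) * angle_moment (n + 2)"
      using angle_moment_rec[of n] by simp
    then show ?case using ge2.prems(5)[of n] by simp
  qed (use haar_moment_odd[of 1] in simp_all)
qed

section \<open>Orthonormality of the characters\<close>

text \<open>\<open>chebyshev_U n\<close> is the Chebyshev polynomial of the second kind usually
  numbered \<open>n - 1\<close>, so that the index is the dimension \<open>2 * l + 1\<close> of the
  representation. The joint recursion mirrors the addition formulas for \<open>sin\<close> and
  \<open>cos\<close>; \<open>[:1, 0, - 1:]\<close> stands for the square of the sine.\<close>

fun chebyshev_U :: "nat \<Rightarrow> real poly" and chebyshev_T :: "nat \<Rightarrow> real poly" where
  "chebyshev_U 0 = 0"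
| "chebyshev_U (Suc n) = [:0, 1:] * chebyshev_U n + chebyshev_T n"
| "chebyshev_T 0 = 1"
| "chebyshev_T (Suc n) = [:0, 1:] * chebyshev_T n - [:1, 0, - 1:] * chebyshev_U n"

lemma chebyshev_cos:
  "sin x * poly (chebyshev_U n) (cos x) = sin (real n * x) \<and>
   poly (chebyshev_T n) (cos x) = cos (real n * x)"
proof (induction n)
  case (Suc n)
  have "sin (real (Suc n) * x) = sin (real n * x) * cos x + cos (real n * x) * sin x"
    "cos (real (Suc n) * x) = cos (real n * x) * cos x - sin (real n * x) * sin x"
    by (simp_all add: distrib_right sin_add cos_add add.commute[of x])
  moreover have "1 - cos x * cos x = sin x * sin x"
    using sin_squared_eq[of x] by (simp add: power2_eq_square)
  moreover have "poly (chebyshev_U (Suc n)) (cos x) =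
      cos x * poly (chebyshev_U n) (cos x) + poly (chebyshev_T n) (cos x)"
    "poly (chebyshev_T (Suc n)) (cos x) =
      cos x * poly (chebyshev_T n) (cos x) - (1 - cos x * cos x) * poly (chebyshev_U n) (cos x)"
    by (simp_all add: algebra_simps)
  ultimately show ?case
    using Suc by (intro conjI) algebra+
qed simp

lemma sin_mult_chebyshev_U: "sin x * poly (chebyshev_U n) (cos x) = sin (real n * x)"
  using chebyshev_cos by blast

text \<open>Each step of the recursion adds a cosine, of absolute value at most 1. Arguing on the
  polynomial rather than on the quotient of sines covers the zeros of \<open>sin x\<close> as
  well.\<close>

lemma abs_chebyshev_U_le: "\<bar>poly (chebyshev_U n) (cos x)\<bar> \<le> real n"
proof (induction n)
  case (Suc n)
  have "\<bar>cos x * poly (chebyshev_U n) (cos x)\<bar> \<le> 1 * real n"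
    unfolding abs_mult using Suc by (intro mult_mono) auto
  moreover have "\<bar>poly (chebyshev_T n) (cos x)\<bar> \<le> 1"
    using chebyshev_cos by simp
  ultimately show ?case by simp
qed simp

text \<open>Inside the interval the sine may be cancelled; at the endpoints the continuity of the
  polynomial supplies the limit in the definition of \<open>psi\<close>.\<close>

lemma psi_eq_chebyshev_U:
  assumes t: "t \<in> {0..1}"
  shows "psi (real k / 2) t = poly (chebyshev_U (k + 1)) (cos (pi * t))"
proof -
  have inner: "sin ((2 * (real k / 2) + 1) * pi * s) / sin (pi * s) =
      poly (chebyshev_U (k + 1)) (cos (pi * s))" if "s \<in> {0<..<1}" for s
  proof -
    have "sin (pi * s) > 0" using that by (intro sin_gt_zero) auto
    then show ?thesis
      using sin_mult_chebyshev_U[of "pi * s" "k + 1"] by (simp add: field_simps)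
  qed
  show ?thesis
  proof (cases "t \<in> {0<..<1}")
    case True
    then show ?thesis using inner by (simp add: psi_def)
  next
    case False
    then have t': "t = 0 \<or> t = 1" using t by auto
    have nt: "at t within {0<..<1} \<noteq> bot"
      using t' islimpt_greaterThanLessThan1[of 0 "1::real"] islimpt_greaterThanLessThan2[of 0 "1::real"]
      by (auto simp: trivial_limit_within)
    have "((\<lambda>s. poly (chebyshev_U (k + 1)) (cos (pi * s))) \<longlongrightarrow>
        poly (chebyshev_U (k + 1)) (cos (pi * t))) (at t within {0<..<1})"
      by (intro tendsto_intros)
    then have "((\<lambda>s. sin ((2 * (real k / 2) + 1) * pi * s) / sin (pi * s)) \<longlongrightarrow>
        poly (chebyshev_U (k + 1)) (cos (pi * t))) (at t within {0<..<1})"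
      by (rule tendsto_cong[THEN iffD2, rotated])
        (unfold eventually_at_filter, intro always_eventually allI impI inner)
    then have "Lim (at t within {0<..<1}) (\<lambda>s. sin ((2 * (real k / 2) + 1) * pi * s) / sin (pi * s)) =
        poly (chebyshev_U (k + 1)) (cos (pi * t))"
      by (rule tendsto_Lim[OF nt])
    then show ?thesis using False by (simp only: psi_def if_False)
  qed
qed

definition character :: "nat \<Rightarrow> real \<Rightarrow> real" where
  "character n t = poly (chebyshev_U n) (cos (pi * t))"

lemma abs_character_le: "\<bar>character n t\<bar> \<le> real n"
  by (simp add: character_def abs_chebyshev_U_le)

lemma measurable_class_angle:
  "(\<lambda>A. arccos (Re (A$1$1)) / pi) \<in> haar_SU2 \<rightarrow>\<^sub>M restrict_space borel {0..1}"
proof (rule measurable_restrict_space2)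
  have "continuous_on SU2 (\<lambda>A. arccos (Re (A$1$1)) / pi)"
    using SU2_coordinates_le_1(1) by (intro continuous_intros) (auto simp: abs_le_iff)
  then show "(\<lambda>A. arccos (Re (A$1$1)) / pi) \<in> borel_measurable haar_SU2"
    using borel_measurable_continuous_on_restrict measurable_cong_sets[OF sets_haar_SU2 refl] by blast
  show "(\<lambda>A. arccos (Re (A$1$1)) / pi) \<in> space haar_SU2 \<rightarrow> {0..1}"
  proof
    fix A assume "A \<in> space haar_SU2"
    then have "-1 \<le> Re (A$1$1)" "Re (A$1$1) \<le> 1"
      using SU2_coordinates_le_1(1)[of A] by (auto simp: abs_le_iff)
    then show "arccos (Re (A$1$1)) / pi \<in> {0..1}"
      using arccos_lbound[of "Re (A$1$1)"] arccos_ubound[of "Re (A$1$1)"] by simp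
  qed
qed

lemma conj_haar_eq:
  "conj_haar = distr haar_SU2 (restrict_space borel {0..1}) (\<lambda>A. arccos (Re (A$1$1)) / pi)"
  unfolding conj_haar_def by (rule distr_cong) (simp_all add: class_param_conj_class)

lemma sets_conj_haar [measurable_cong, simp]: "sets conj_haar = sets (restrict_space borel {0..1})"
  by (simp add: conj_haar_eq)

lemma space_conj_haar [simp]: "space conj_haar = {0..1}"
  by (simp add: conj_haar_eq space_restrict_space)

lemma prob_space_conj_haar: "prob_space conj_haar"
  unfolding conj_haar_eq by (rule haar.prob_space_distr[OF measurable_class_angle])

lemma measurable_poly_cos: "(\<lambda>t. poly P (cos (pi * t))) \<in> borel_measurable (restrict_space borel {0..1})"
  by (intro borel_measurable_continuous_on_restrict continuous_intros)

lemma measurable_character [measurable]: "character n \<in> borel_measurable conj_haar"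
  unfolding character_def using measurable_poly_cos measurable_cong_sets[OF sets_conj_haar refl] by blast

text \<open>This is the Weyl integration formula for polynomials in half the trace. Both sides are
  linear in the coefficients of \<open>P\<close>, so equality of moments is enough.\<close>

lemma integral_conj_haar_poly:
  "(LINT t|conj_haar. poly P (cos (pi * t))) =
     2 / pi * integral {0..pi} (\<lambda>x. poly P (cos x) * (sin x)\<^sup>2)"
proof -
  have "(LINT t|conj_haar. poly P (cos (pi * t))) =
      (LINT A|haar_SU2. poly P (cos (pi * (arccos (Re (A$1$1)) / pi))))"
    unfolding conj_haar_eq by (rule integral_distr[OF measurable_class_angle measurable_poly_cos])
  also have "\<dots> = (LINT A|haar_SU2. (\<Sum>i\<le>degree P. coeff P i * Re (A$1$1) ^ i))"
    using SU2_coordinates_le_1(1)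
    by (intro Bochner_Integration.integral_cong) (auto simp: cos_arccos_abs poly_altdef)
  also have "\<dots> = (\<Sum>i\<le>degree P. coeff P i * haar_moment i)"
  proof -
    have "integrable haar_SU2 (\<lambda>A. Re (A$1$1) ^ i)" for i
      using integrable_haar_SU2_monomial[of "\<lambda>A. Re (A$1$1)" "\<lambda>A. Re (A$1$1)" i 0]
        SU2_coordinates_le_1 by simp
    then show ?thesis by (simp add: haar_moment_def)
  qed
  also have "\<dots> = 2 / pi * (\<Sum>i\<le>degree P. coeff P i * integral {0..pi} (\<lambda>x. cos x ^ i * (sin x)\<^sup>2))"
    by (simp add: haar_moment_eq angle_moment_def sum_distrib_left mult_ac)
  also have "(\<Sum>i\<le>degree P. coeff P i * integral {0..pi} (\<lambda>x. cos x ^ i * (sin x)\<^sup>2)) =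
      (\<Sum>i\<le>degree P. integral {0..pi} (\<lambda>x. coeff P i * (cos x ^ i * (sin x)\<^sup>2)))"
    by simp
  also have "\<dots> = integral {0..pi} (\<lambda>x. \<Sum>i\<le>degree P. coeff P i * (cos x ^ i * (sin x)\<^sup>2))"
    by (intro integral_sum[symmetric] integrable_continuous_interval continuous_intros) auto
  also have "\<dots> = integral {0..pi} (\<lambda>x. poly P (cos x) * (sin x)\<^sup>2)"
    by (simp add: poly_altdef sum_distrib_left mult_ac)
  finally show ?thesis .
qed

lemma character_orthonormal:
  assumes "m > 0" "n > 0"
  shows "(LINT t|conj_haar. character m t * character n t) = (if m = n then 1 else 0)"
proof -
  have "(LINT t|conj_haar. character m t * character n t) =
      2 / pi * integral {0..pi} (\<lambda>x. poly (chebyshev_U m * chebyshev_U n) (cos x) * (sin x)\<^sup>2)"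
    unfolding integral_conj_haar_poly[symmetric] by (simp add: character_def)
  also have "(\<lambda>x. poly (chebyshev_U m * chebyshev_U n) (cos x) * (sin x)\<^sup>2) =
      (\<lambda>x. sin (real m * x) * sin (real n * x))"
    unfolding sin_mult_chebyshev_U[symmetric] by (simp add: power2_eq_square mult_ac)
  finally show ?thesis using integral_sin_mult_sin[OF assms] by simp
qed

lemma fourier_eq:
  "fourier f (real k / 2) =
     (LINT t|conj_haar. f t * of_real (character (k + 1) t)) / of_nat (k + 1)"
proof -
  have "fourier f (real k / 2) =
      (LINT t|conj_haar. f t * of_real (character (k + 1) t) / of_nat (k + 1))"
    unfolding fourier_def
    by (intro Bochner_Integration.integral_cong)
      (auto simp: chi_def psi_eq_chebyshev_U character_def add.commute)
  then show ?thesis by simp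
qed

section \<open>The Hardy--Littlewood inequality\<close>

lemma powr_add_le:
  fixes a b p :: real
  assumes "0 \<le> a" "0 \<le> b" "0 \<le> p" "p \<le> 2"
  shows "(a + b) powr p \<le> 4 * (a powr p + b powr p)"
proof -
  have "(a + b) powr p \<le> (2 * max a b) powr p" using assms by (intro powr_mono2) auto
  also have "\<dots> = 2 powr p * max a b powr p" using assms by (simp add: powr_mult)
  also have "\<dots> \<le> 2 powr 2 * max a b powr p"
    using assms by (intro mult_right_mono powr_mono) auto
  also have "max a b powr p \<le> a powr p + b powr p" by (simp add: max_def)
  finally show ?thesis by simp
qed

text \<open>For \<open>t\<close> above \<open>a\<close> compare \<open>t powr (p - 2)\<close> with
  \<open>a powr (p - 2)\<close>, otherwise compare \<open>t powr p\<close> with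
  \<open>a powr p\<close>. Summed over a finite block this trades \<open>p\<close>-th powers for
  squares, in the role of Hoelder's inequality.\<close>

lemma powr_le_threshold:
  fixes a t p :: real
  assumes "0 < a" "0 \<le> t" "0 \<le> p" "p \<le> 2"
  shows "t powr p \<le> a powr (p - 2) * t\<^sup>2 + a powr p"
proof (cases "t \<le> a")
  case True
  then have "t powr p \<le> a powr p" using assms by (intro powr_mono2) auto
  then show ?thesis by (simp add: add_increasing)
next
  case False
  then have "t powr (p - 2) \<le> a powr (p - 2)" using assms by (intro powr_mono2') auto
  then have "t powr (p - 2) * t\<^sup>2 \<le> a powr (p - 2) * t\<^sup>2" by (intro mult_right_mono) auto
  moreover have "t powr (p - 2) * t\<^sup>2 = t powr p"
    using False assms by (simp add: powr_diff)
  ultimately show ?thesis by (simp add: add_increasing2)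
qed

text \<open>The inequality is proved for any orthonormal system on a probability space whose
  \<open>n\<close>-th member is bounded by \<open>n\<close>. Index 0 is outside the orthonormality
  assumption, hence the recurring condition \<open>0 \<notin> K\<close>.\<close>

locale orthonormal_characters = prob_space M for M :: "'a measure" +
  fixes e :: "nat \<Rightarrow> 'a \<Rightarrow> real"
  assumes measurable_e [measurable]: "e n \<in> borel_measurable M"
    and abs_e_le: "x \<in> space M \<Longrightarrow> \<bar>e n x\<bar> \<le> real n"
    and orthonormal: "m > 0 \<Longrightarrow> n > 0 \<Longrightarrow> (LINT x|M. e m x * e n x) = (if m = n then 1 else 0)"
begin

definition coef :: "('a \<Rightarrow> complex) \<Rightarrow> nat \<Rightarrow> complex" where
  "coef f n = (LINT x|M. f x * of_real (e n x))"

lemma integrable_mult_e: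
  fixes f :: "'a \<Rightarrow> 'b::{banach, second_countable_topology, real_normed_field}"
  assumes "integrable M f"
  shows "integrable M (\<lambda>x. f x * of_real (e n x))"
proof (rule Bochner_Integration.integrable_bound)
  show "integrable M (\<lambda>x. real n *\<^sub>R f x)" using assms by simp
  show "AE x in M. norm (f x * of_real (e n x)) \<le> norm (real n *\<^sub>R f x)"
    using abs_e_le by (auto intro!: AE_I2 simp: norm_mult mult.commute[of "real n"] intro: mult_left_mono)
qed (use assms in measurable)

text \<open>Constants are integrable on a probability space, so the pointwise bound
  \<open>t \<le> 1 + t powr p\<close> suffices.\<close>

lemma integrable_of_integrable_powr:
  fixes f :: "'a \<Rightarrow> complex"
  assumes [measurable]: "f \<in> borel_measurable M" and p: "1 \<le> p"
    and int: "integrable M (\<lambda>x. norm (f x) powr p)"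
  shows "integrable M f"
proof (rule Bochner_Integration.integrable_bound)
  show "integrable M (\<lambda>x. 1 + norm (f x) powr p)" using int by simp
  have "t \<le> 1 + t powr p" if "t \<ge> 0" for t :: real
  proof (cases "t \<le> 1")
    case False
    then have "t powr 1 \<le> t powr p" using p by (intro powr_mono) auto
    then show ?thesis using False by simp
  qed (simp add: add_increasing2)
  then show "AE x in M. norm (f x) \<le> norm (1 + norm (f x) powr p)"
    by (intro AE_I2) (simp add: abs_of_nonneg add_nonneg_nonneg)
qed simp

text \<open>With \<open>s\<close> the partial Fourier sum over \<open>K\<close>, the integral of the
  square of \<open>f - s\<close> is nonnegative, and orthonormality reduces it to the difference of
  the two sides.\<close>

lemma bessel_real:
  fixes f :: "'a \<Rightarrow> real"
  assumes [measurable]: "f \<in> borel_measurable M" and f2: "integrable M (\<lambda>x. (f x)\<^sup>2)"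
    and K: "finite K" "0 \<notin> K"
  shows "(\<Sum>n\<in>K. (LINT x|M. f x * e n x)\<^sup>2) \<le> (LINT x|M. (f x)\<^sup>2)"
proof -
  define c where "c n = (LINT x|M. f x * e n x)" for n
  define s where "s x = (\<Sum>n\<in>K. c n * e n x)" for x
  have f1: "integrable M f" by (rule square_integrable_imp_integrable) (use f2 in simp_all)
  have fe: "integrable M (\<lambda>x. f x * e n x)" for n using integrable_mult_e[OF f1, of n] by simp
  have e1: "integrable M (e n)" for n using integrable_mult_e[of "\<lambda>_. 1 :: real" n] by simp
  have ee: "integrable M (\<lambda>x. e m x * e n x)" for m n using integrable_mult_e[OF e1] by simp
  have fs: "(\<lambda>x. f x * s x) = (\<lambda>x. \<Sum>n\<in>K. c n * (f x * e n x))"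
    by (simp add: s_def sum_distrib_left mult_ac)
  have ss: "(\<lambda>x. (s x)\<^sup>2) = (\<lambda>x. \<Sum>m\<in>K. \<Sum>n\<in>K. c m * c n * (e m x * e n x))"
    by (simp add: s_def power2_eq_square sum_product mult_ac)
  have "integrable M (\<lambda>x. f x * s x)" unfolding fs using fe by simp
  moreover have "(LINT x|M. f x * s x) = (\<Sum>n\<in>K. (c n)\<^sup>2)"
    unfolding fs using fe by (simp add: power2_eq_square flip: c_def)
  moreover have "integrable M (\<lambda>x. (s x)\<^sup>2)" unfolding ss using ee by simp
  moreover have "(LINT x|M. (s x)\<^sup>2) = (\<Sum>n\<in>K. (c n)\<^sup>2)"
  proof -
    have "(LINT x|M. (s x)\<^sup>2) = (\<Sum>m\<in>K. \<Sum>n\<in>K. c m * c n * (LINT x|M. e m x * e n x))"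
      unfolding ss using ee by simp
    also have "\<dots> = (\<Sum>m\<in>K. \<Sum>n\<in>K. if m = n then c m * c n else 0)"
    proof (intro sum.cong refl)
      fix m n assume "m \<in> K" "n \<in> K"
      then have "m > 0" "n > 0" using K by (metis gr0I)+
      then show "c m * c n * (LINT x|M. e m x * e n x) = (if m = n then c m * c n else 0)"
        by (simp add: orthonormal)
    qed
    finally show ?thesis using K by (simp add: power2_eq_square)
  qed
  ultimately have "(LINT x|M. (f x)\<^sup>2 - 2 * (f x * s x) + (s x)\<^sup>2) =
      (LINT x|M. (f x)\<^sup>2) - (\<Sum>n\<in>K. (c n)\<^sup>2)"
    using f2 by simp
  moreover have "(LINT x|M. (f x)\<^sup>2 - 2 * (f x * s x) + (s x)\<^sup>2) = (LINT x|M. (f x - s x)\<^sup>2)"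
    by (simp add: power2_diff algebra_simps)
  moreover have "\<dots> \<ge> 0" by (intro Bochner_Integration.integral_nonneg) simp
  ultimately show ?thesis unfolding c_def by linarith
qed

lemma bessel:
  fixes f :: "'a \<Rightarrow> complex"
  assumes [measurable]: "f \<in> borel_measurable M" and f2: "integrable M (\<lambda>x. (norm (f x))\<^sup>2)"
    and K: "finite K" "0 \<notin> K"
  shows "(\<Sum>n\<in>K. (norm (coef f n))\<^sup>2) \<le> (LINT x|M. (norm (f x))\<^sup>2)"
proof -
  have "integrable M (\<lambda>x. norm (f x) powr 2)" using f2 by simp
  then have "integrable M f" by (intro integrable_of_integrable_powr[of f 2]) auto
  then have i: "integrable M (\<lambda>x. f x * of_real (e n x))" for n by (rule integrable_mult_e)
  have "Re (coef f n) = (LINT x|M. Re (f x) * e n x)" "Im (coef f n) = (LINT x|M. Im (f x) * e n x)" for n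
    unfolding coef_def using integral_Re[OF i[of n]] integral_Im[OF i[of n]] by simp_all
  then have "(\<Sum>n\<in>K. (norm (coef f n))\<^sup>2) =
      (\<Sum>n\<in>K. (LINT x|M. Re (f x) * e n x)\<^sup>2) + (\<Sum>n\<in>K. (LINT x|M. Im (f x) * e n x)\<^sup>2)"
    by (simp add: cmod_power2 sum.distrib)
  moreover have RI: "integrable M (\<lambda>x. (Re (f x))\<^sup>2)" "integrable M (\<lambda>x. (Im (f x))\<^sup>2)"
    by (rule Bochner_Integration.integrable_bound[OF f2]; auto simp: cmod_power2)+
  moreover have "(LINT x|M. (norm (f x))\<^sup>2) = (LINT x|M. (Re (f x))\<^sup>2) + (LINT x|M. (Im (f x))\<^sup>2)"
    using RI by (simp add: cmod_power2)
  ultimately show ?thesis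
    using bessel_real[of "\<lambda>x. Re (f x)" K] bessel_real[of "\<lambda>x. Im (f x)" K] K by simp
qed

text \<open>
  \<open>f\<close> is split at the height \<open>N powr (5 / p)\<close>: the bounded part is controlled by Bessel's
  inequality, the other one by \<open>\<bar>e n\<bar> \<le> n\<close>. With this height both contributions decay in \<open>N\<close>.
\<close>

lemma dyadic_block_bound:
  fixes f :: "'a \<Rightarrow> complex"
  assumes p: "1 < p" "p < 2" and [measurable]: "f \<in> borel_measurable M"
    and int: "integrable M (\<lambda>x. norm (f x) powr p)" and F1: "(LINT x|M. norm (f x) powr p) \<le> 1"
    and N: "N \<ge> 1"
  shows "(\<Sum>n\<in>{N..<2*N}. real n powr (5 * p - 8) * (norm (coef f n) / real n) powr p)
    \<le> 48 * real N powr (p - 2)"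
proof -
  \<comment> \<open>The exponent \<open>5 / p\<close> cancels the \<open>p\<close> in the weight
    exponent \<open>5 * p - 8\<close>: in \<open>e3\<close> the unbounded part ends up with the
    exponent \<open>-2\<close>. The threshold \<open>a\<close> for \<open>powr_le_threshold\<close>
    is then chosen so that its two terms, summed over the \<open>N\<close> frequencies of the block,
    have equal size; \<open>e1\<close> and \<open>e2\<close> confirm this.\<close>
  define L where "L = real N powr (5 / p)"
  define a where "a = real N powr (5 / p - 4)"
  define g where "g x = (if norm (f x) \<le> L then f x else 0)" for x
  define h where "h x = (if norm (f x) \<le> L then 0 else f x)" for x
  define G where "G n = norm (coef g n) / real n" for n
  have N0: "real N > 0" using N by simp
  have L: "L > 0" and a: "a > 0" using N0 by (simp_all add: L_def a_def)
  have [measurable]: "g \<in> borel_measurable M" "h \<in> borel_measurable M"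
    unfolding g_def h_def by measurable
  have f1: "integrable M f" using int p by (intro integrable_of_integrable_powr[of f p]) auto
  have g1: "integrable M g" and h1: "integrable M h"
    by (rule Bochner_Integration.integrable_bound[OF f1]; auto simp: g_def h_def)+
  have coef_f: "coef f n = coef g n + coef h n" for n
  proof -
    have "coef f n = (LINT x|M. g x * of_real (e n x) + h x * of_real (e n x))"
      unfolding coef_def
      by (intro Bochner_Integration.integral_cong) (auto simp: g_def h_def)
    then show ?thesis
      using integrable_mult_e[OF g1] integrable_mult_e[OF h1] by (simp add: coef_def)
  qed
  have coef_h: "norm (coef h n) / real n \<le> L powr (1 - p)" if "n > 0" for n
  proof -
    have "norm (coef h n) \<le> (LINT x|M. norm (h x * of_real (e n x)))"
      unfolding coef_def by (rule integral_norm_bound)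
    also have "\<dots> \<le> (LINT x|M. real n * (L powr (1 - p) * norm (f x) powr p))"
    proof (intro integral_mono)
      fix x assume x: "x \<in> space M"
      \<comment> \<open>Where \<open>h\<close> is nonzero, \<open>norm (f x)\<close> exceeds
        \<open>L\<close>, and the power \<open>1 - p\<close> is negative.\<close>
      have "norm (h x) \<le> L powr (1 - p) * norm (f x) powr p"
      proof (cases "norm (f x) \<le> L")
        case False
        have "norm (f x) = norm (f x) powr (1 - p) * norm (f x) powr p"
          using False L by (simp flip: powr_add)
        also have "\<dots> \<le> L powr (1 - p) * norm (f x) powr p"
          using False L p by (intro mult_right_mono powr_mono2') auto
        finally show ?thesis using False by (simp add: h_def)
      qed (simp add: h_def)
      then have "norm (h x) * \<bar>e n x\<bar> \<le> (L powr (1 - p) * norm (f x) powr p) * real n"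
        using abs_e_le[OF x] by (intro mult_mono) auto
      then show "norm (h x * of_real (e n x)) \<le> real n * (L powr (1 - p) * norm (f x) powr p)"
        by (simp add: norm_mult mult.commute[of "real n"])
    qed (use int integrable_mult_e[OF h1] in auto)
    also have "\<dots> = real n * (L powr (1 - p) * (LINT x|M. norm (f x) powr p))" by simp
    also have "\<dots> \<le> real n * (L powr (1 - p) * 1)"
      using F1 by (intro mult_left_mono) auto
    finally show ?thesis using that by (simp add: field_simps)
  qed
  have g2: "(norm (g x))\<^sup>2 \<le> L powr (2 - p) * norm (f x) powr p" for x
  proof (cases "norm (f x) \<le> L \<and> f x \<noteq> 0")
    case True
    have "(norm (g x))\<^sup>2 = norm (f x) powr (2 - p) * norm (f x) powr p"
      using True by (simp add: g_def flip: powr_add)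
    also have "\<dots> \<le> L powr (2 - p) * norm (f x) powr p"
      using True p by (intro mult_right_mono powr_mono2) auto
    finally show ?thesis .
  qed (auto simp: g_def)
  have int_g2: "integrable M (\<lambda>x. (norm (g x))\<^sup>2)"
    by (rule Bochner_Integration.integrable_bound[of _ "\<lambda>x. L powr (2 - p) * norm (f x) powr p"])
      (use int g2 in auto)
  have "(\<Sum>n\<in>{N..<2*N}. (norm (coef g n))\<^sup>2) \<le> (LINT x|M. (norm (g x))\<^sup>2)"
    using N by (intro bessel int_g2) auto
  also have "\<dots> \<le> (LINT x|M. L powr (2 - p) * norm (f x) powr p)"
    by (intro integral_mono int_g2 g2) (use int in simp)
  also have "\<dots> \<le> L powr (2 - p)" using F1 by (simp add: mult_left_le)
  finally have sum_g: "(\<Sum>n\<in>{N..<2*N}. (norm (coef g n))\<^sup>2) \<le> L powr (2 - p)" .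
  have "(\<Sum>n\<in>{N..<2*N}. (G n)\<^sup>2) \<le> (\<Sum>n\<in>{N..<2*N}. (norm (coef g n))\<^sup>2 / (real N)\<^sup>2)"
    unfolding G_def power_divide using N0
    by (intro sum_mono divide_left_mono power_mono mult_pos_pos) auto
  also have "\<dots> \<le> L powr (2 - p) / (real N)\<^sup>2"
    unfolding sum_divide_distrib[symmetric] using sum_g by (intro divide_right_mono) auto
  finally have sum_G: "(\<Sum>n\<in>{N..<2*N}. (G n)\<^sup>2) \<le> L powr (2 - p) / (real N)\<^sup>2" .
  \<comment> \<open>The exponent changes sign at \<open>p = 8 / 5\<close>. When it is nonnegative it
    is at most 2, so passing from \<open>N\<close> to \<open>2 * N\<close> costs at most the factor
    4.\<close>
  have weight: "real n powr (5 * p - 8) \<le> 4 * real N powr (5 * p - 8)" if n: "n \<in> {N..<2*N}" for n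
  proof (cases "5 * p - 8 \<ge> 0")
    case True
    have "real n powr (5 * p - 8) \<le> (2 * real N) powr (5 * p - 8)"
      using n True by (intro powr_mono2) auto
    also have "\<dots> = 2 powr (5 * p - 8) * real N powr (5 * p - 8)" by (simp add: powr_mult)
    also have "\<dots> \<le> 2 powr 2 * real N powr (5 * p - 8)"
      using p by (intro mult_right_mono powr_mono) auto
    finally show ?thesis by simp
  next
    case False
    then have "real n powr (5 * p - 8) \<le> real N powr (5 * p - 8)"
      using n N0 by (intro powr_mono2') auto
    also have "\<dots> \<le> 4 * real N powr (5 * p - 8)" by simp
    finally show ?thesis .
  qed
  have summand: "real n powr (5 * p - 8) * (norm (coef f n) / real n) powr p \<le>
      4 * real N powr (5 * p - 8) *
        (4 * (a powr (p - 2) * (G n)\<^sup>2 + a powr p + (L powr (1 - p)) powr p))"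
    if n: "n \<in> {N..<2*N}" for n
  proof (intro mult_mono weight n)
    have n0: "n > 0" using n N by auto
    have "norm (coef f n) / real n \<le> G n + L powr (1 - p)"
      using norm_triangle_ineq[of "coef g n" "coef h n"] coef_h[OF n0] n0
      by (simp add: coef_f G_def field_simps)
    then have "(norm (coef f n) / real n) powr p \<le> (G n + L powr (1 - p)) powr p"
      using p by (intro powr_mono2) auto
    also have "\<dots> \<le> 4 * (G n powr p + (L powr (1 - p)) powr p)"
      using p by (intro powr_add_le) (auto simp: G_def)
    also have "G n powr p \<le> a powr (p - 2) * (G n)\<^sup>2 + a powr p"
      using p a by (intro powr_le_threshold) (auto simp: G_def)
    finally show "(norm (coef f n) / real n) powr p \<le>
        4 * (a powr (p - 2) * (G n)\<^sup>2 + a powr p + (L powr (1 - p)) powr p)"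
      by simp
  qed auto
  have e1: "real N powr (5 * p - 8) * (a powr (p - 2) * (L powr (2 - p) / (real N)\<^sup>2)) = real N powr (p - 2)"
  proof -
    have "real N powr (5 * p - 8) * (a powr (p - 2) * (L powr (2 - p) / (real N)\<^sup>2)) =
        real N powr (5 * p - 8) * (real N powr ((5 / p - 4) * (p - 2)) *
          (real N powr (5 / p * (2 - p)) / real N powr 2))"
      using N0 by (simp add: a_def L_def powr_powr)
    also have "\<dots> = real N powr ((5 * p - 8) + ((5 / p - 4) * (p - 2) + (5 / p * (2 - p) - 2)))"
      by (simp only: powr_add powr_diff)
    also have "(5 * p - 8) + ((5 / p - 4) * (p - 2) + (5 / p * (2 - p) - 2)) = p - 2"
      using p by (simp add: field_simps)
    finally show ?thesis .
  qed
  have e2: "real N powr (5 * p - 8) * (real N * a powr p) = real N powr (p - 2)"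
  proof -
    have "real N powr (5 * p - 8) * (real N * a powr p) =
        real N powr (5 * p - 8) * (real N powr 1 * real N powr ((5 / p - 4) * p))"
      using N0 by (simp add: a_def powr_powr)
    also have "\<dots> = real N powr ((5 * p - 8) + (1 + (5 / p - 4) * p))"
      by (simp only: powr_add)
    also have "(5 * p - 8) + (1 + (5 / p - 4) * p) = p - 2"
      using p by (simp add: field_simps)
    finally show ?thesis .
  qed
  have e3: "real N powr (5 * p - 8) * (real N * (L powr (1 - p)) powr p) \<le> real N powr (p - 2)"
  proof -
    have "real N powr (5 * p - 8) * (real N * (L powr (1 - p)) powr p) =
        real N powr (5 * p - 8) * (real N powr 1 * real N powr (5 / p * (1 - p) * p))"
      using N0 by (simp add: L_def powr_powr)
    also have "\<dots> = real N powr ((5 * p - 8) + (1 + 5 / p * (1 - p) * p))"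
      by (simp only: powr_add)
    also have "(5 * p - 8) + (1 + 5 / p * (1 - p) * p) = -2"
      using p by (simp add: field_simps)
    also have "real N powr (-2) \<le> real N powr (p - 2)" using N p by (intro powr_mono) auto
    finally show ?thesis .
  qed
  have "(\<Sum>n\<in>{N..<2*N}. real n powr (5 * p - 8) * (norm (coef f n) / real n) powr p) \<le>
      (\<Sum>n\<in>{N..<2*N}. 4 * real N powr (5 * p - 8) *
        (4 * (a powr (p - 2) * (G n)\<^sup>2 + a powr p + (L powr (1 - p)) powr p)))"
    by (intro sum_mono summand)
  \<comment> \<open>The factor 16 is 4 from \<open>weight\<close> times 4 from
    \<open>powr_add_le\<close>; the block has \<open>N\<close> members, which gives the factors
    \<open>real N\<close>. Three equal bounds then make 48.\<close>
  also have "\<dots> = 16 * (real N powr (5 * p - 8) * (a powr (p - 2) * (\<Sum>n\<in>{N..<2*N}. (G n)\<^sup>2)) +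
      real N powr (5 * p - 8) * (real N * a powr p) +
      real N powr (5 * p - 8) * (real N * (L powr (1 - p)) powr p))"
    by (simp add: sum.distrib sum_distrib_left algebra_simps)
  also have "\<dots> \<le> 16 * (real N powr (5 * p - 8) * (a powr (p - 2) * (L powr (2 - p) / (real N)\<^sup>2)) +
      real N powr (5 * p - 8) * (real N * a powr p) +
      real N powr (5 * p - 8) * (real N * (L powr (1 - p)) powr p))"
    using sum_G by (intro mult_left_mono add_mono order.refl) auto
  also have "\<dots> \<le> 16 * (real N powr (p - 2) + real N powr (p - 2) + real N powr (p - 2))"
    using e1 e2 e3 by simp
  finally show ?thesis by simp
qed

text \<open>For \<open>p < 2\<close> the block bounds form a geometric series of ratio
  \<open>q = 2 powr (p - 2)\<close>. At \<open>p = 2\<close> that ratio is 1, but there the weight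
  \<open>n\<^sup>2\<close> exactly cancels the division by \<open>n\<close> and Bessel's inequality
  applies with constant 1.\<close>

lemma normalized_coef_sum_bound:
  assumes p: "1 < p" "p \<le> 2"
  shows "\<exists>C>0. \<forall>f K. f \<in> borel_measurable M \<longrightarrow> integrable M (\<lambda>x. norm (f x) powr p) \<longrightarrow>
    (LINT x|M. norm (f x) powr p) \<le> 1 \<longrightarrow> finite K \<longrightarrow> 0 \<notin> K \<longrightarrow>
    (\<Sum>n\<in>K. real n powr (5 * p - 8) * (norm (coef f n) / real n) powr p) \<le> C"
proof (cases "p = 2")
  case True
  show ?thesis
  proof (intro exI[of _ 1] conjI allI impI)
    fix f :: "'a \<Rightarrow> complex" and K :: "nat set"
    assume f: "f \<in> borel_measurable M" "integrable M (\<lambda>x. norm (f x) powr p)"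
      "(LINT x|M. norm (f x) powr p) \<le> 1" and K: "finite K" "0 \<notin> K"
    have "real n powr (5 * p - 8) * (norm (coef f n) / real n) powr p = (norm (coef f n))\<^sup>2"
      if "n \<in> K" for n
    proof -
      have "n > 0" using that K by (intro Nat.gr0I) auto
      then show ?thesis by (simp add: True power_divide)
    qed
    then have "(\<Sum>n\<in>K. real n powr (5 * p - 8) * (norm (coef f n) / real n) powr p) =
        (\<Sum>n\<in>K. (norm (coef f n))\<^sup>2)"
      by (rule sum.cong[OF refl])
    also have "\<dots> \<le> (LINT x|M. (norm (f x))\<^sup>2)" using f K by (intro bessel) (auto simp: True)
    also have "\<dots> \<le> 1" using f by (simp add: True)
    finally show "(\<Sum>n\<in>K. real n powr (5 * p - 8) * (norm (coef f n) / real n) powr p) \<le> 1" .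
  qed simp
next
  case False
  then have p2: "p < 2" using p by simp
  define q :: real where "q = 2 powr (p - 2)"
  have q: "0 < q" "q < 1"
    using p2 powr_less_mono[of "p - 2" 0 "2 :: real"] by (simp_all add: q_def)
  show ?thesis
  proof (intro exI[of _ "48 / (1 - q)"] conjI allI impI)
    show "0 < 48 / (1 - q)" using q by simp
    fix f :: "'a \<Rightarrow> complex" and K :: "nat set"
    assume f: "f \<in> borel_measurable M" "integrable M (\<lambda>x. norm (f x) powr p)"
      "(LINT x|M. norm (f x) powr p) \<le> 1" and K: "finite K" "0 \<notin> K"
    define t where "t n = real n powr (5 * p - 8) * (norm (coef f n) / real n) powr p" for n
    have block: "(\<Sum>n\<in>{1..<2 ^ J}. t n) \<le> (\<Sum>j<J. 48 * q ^ j)" for J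
    proof (induction J)
      case (Suc J)
      have "(\<Sum>n\<in>{1..<2 ^ Suc J}. t n) = (\<Sum>n\<in>{1..<2 ^ J}. t n) + (\<Sum>n\<in>{2 ^ J..<2 * 2 ^ J}. t n)"
        by (subst sum.atLeastLessThan_concat) auto
      also have "(\<Sum>n\<in>{2 ^ J..<2 * 2 ^ J}. t n) \<le> 48 * real (2 ^ J) powr (p - 2)"
        unfolding t_def using p p2 f by (intro dyadic_block_bound) auto
      also have "real (2 ^ J) powr (p - 2) = q ^ J"
        by (simp add: q_def powr_powr mult.commute flip: powr_realpow)
      finally show ?case using Suc by simp
    qed simp
    obtain J where J: "\<And>n. n \<in> K \<Longrightarrow> n < 2 ^ J"
    proof -
      have "n < 2 ^ Max K" if "n \<in> K" for n
        using that K Max_ge[of K n] less_exp[of "Max K"] by linarith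
      then show ?thesis using that by blast
    qed
    have "K \<subseteq> {1..<2 ^ J}"
      using J K by (force simp: Suc_le_eq intro: Nat.gr0I)
    then have "(\<Sum>n\<in>K. t n) \<le> (\<Sum>n\<in>{1..<2 ^ J}. t n)"
      by (intro sum_mono2) (auto simp: t_def)
    also have "\<dots> \<le> (\<Sum>j<J. 48 * q ^ j)" by (rule block)
    also have "\<dots> = 48 * ((1 - q ^ J) / (1 - q))"
      using q by (simp add: sum_gp_strict flip: sum_distrib_left)
    also have "\<dots> \<le> 48 / (1 - q)" using q by (simp add: divide_right_mono)
    finally show "(\<Sum>n\<in>K. real n powr (5 * p - 8) * (norm (coef f n) / real n) powr p) \<le> 48 / (1 - q)"
      by (simp add: t_def)
  qed
qed

lemma coef_sum_bound:
  assumes p: "1 < p" "p \<le> 2"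
  obtains C where "C > 0"
    "\<And>f K. f \<in> borel_measurable M \<Longrightarrow> integrable M (\<lambda>x. norm (f x) powr p) \<Longrightarrow> finite K \<Longrightarrow> 0 \<notin> K \<Longrightarrow>
      (\<Sum>n\<in>K. real n powr (5 * p - 8) * (norm (coef f n) / real n) powr p)
        \<le> C * (LINT x|M. norm (f x) powr p)"
proof -
  obtain C where C: "C > 0" and bound:
    "\<And>f K. f \<in> borel_measurable M \<Longrightarrow> integrable M (\<lambda>x. norm (f x) powr p) \<Longrightarrow>
      (LINT x|M. norm (f x) powr p) \<le> 1 \<Longrightarrow> finite K \<Longrightarrow> 0 \<notin> K \<Longrightarrow>
      (\<Sum>n\<in>K. real n powr (5 * p - 8) * (norm (coef f n) / real n) powr p) \<le> C"
    using normalized_coef_sum_bound[OF p] by auto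
  show thesis
  proof (rule that[OF C])
    fix f :: "'a \<Rightarrow> complex" and K :: "nat set"
    assume f: "f \<in> borel_measurable M" "integrable M (\<lambda>x. norm (f x) powr p)"
      and K: "finite K" "0 \<notin> K"
    let ?S = "\<lambda>f. \<Sum>n\<in>K. real n powr (5 * p - 8) * (norm (coef f n) / real n) powr p"
    let ?F = "LINT x|M. norm (f x) powr p"
    \<comment> \<open>Homogeneity: \<open>f\<close> is divided by the \<open>p\<close>-th root of
      some \<open>R\<close> strictly above \<open>?F\<close>. Working with every such
      \<open>R\<close>, instead of \<open>?F\<close> itself, avoids dividing by zero when
      \<open>?F = 0\<close>.\<close>
    have "?S f / C \<le> R" if R: "?F < R" for R
    proof -
      have "0 \<le> ?F" by (intro Bochner_Integration.integral_nonneg) simp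
      then have R0: "R > 0" using R by linarith
      define r where "r = R powr (1 / p)"
      have r: "r > 0" "r powr p = R" using R0 p by (simp_all add: r_def powr_powr)
      have n: "norm (f x / of_real r) powr p = norm (f x) powr p / R" for x
        using r by (simp add: norm_divide powr_divide)
      have "coef (\<lambda>x. f x / of_real r) n = coef f n / of_real r" for n
        by (simp add: coef_def)
      then have "real n powr (5 * p - 8) * (norm (coef (\<lambda>x. f x / of_real r) n) / real n) powr p =
          (real n powr (5 * p - 8) * (norm (coef f n) / real n) powr p) / R" for n
        using r by (simp add: norm_divide powr_divide powr_mult)
      then have "?S (\<lambda>x. f x / of_real r) = ?S f / R" by (simp add: sum_divide_distrib)
      moreover have "?S (\<lambda>x. f x / of_real r) \<le> C"
        using f K R R0 by (intro bound) (simp_all add: n)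
      ultimately have "?S f / R \<le> C" by (simp only:)
      then show ?thesis using R0 C by (simp add: field_simps)
    qed
    then have "?S f / C \<le> ?F" by (rule dense_ge)
    then show "?S f \<le> C * ?F" using C by (simp add: field_simps)
  qed
qed

end

section \<open>Transfer to the Fourier coefficients on Conj(SU(2))\<close>

interpretation conj_haar: orthonormal_characters conj_haar character
  by (intro orthonormal_characters.intro orthonormal_characters_axioms.intro prob_space_conj_haar
      measurable_character abs_character_le character_orthonormal)

lemma fourier_eq_coef: "fourier f (real k / 2) = conj_haar.coef f (Suc k) / of_nat (Suc k)"
  using fourier_eq[of f k] by (simp add: conj_haar.coef_def)

theorem theorem1p2:
  fixes p :: real
  assumes "1 < p" and "p \<le> 2"
  shows "\<exists>C>0. \<forall>f. Lp_fun p f \<longrightarrow>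
    (\<lambda>l. (2 * l + 1) powr (5 * p - 8) * norm (fourier f l) powr p) summable_on half_nats \<and>
    (\<Sum>\<^sub>\<infinity>l\<in>half_nats. (2 * l + 1) powr (5 * p - 8) * norm (fourier f l) powr p)
      \<le> C * Lp_norm p f powr p"
proof -
  obtain C where C: "C > 0" and bound: "\<And>f K. f \<in> borel_measurable conj_haar \<Longrightarrow>
      integrable conj_haar (\<lambda>x. norm (f x) powr p) \<Longrightarrow> finite K \<Longrightarrow> 0 \<notin> K \<Longrightarrow>
      (\<Sum>n\<in>K. real n powr (5 * p - 8) * (norm (conj_haar.coef f n) / real n) powr p)
        \<le> C * (LINT x|conj_haar. norm (f x) powr p)"
    using conj_haar.coef_sum_bound[OF assms] by blast
  show ?thesis
  proof (intro exI[of _ C] conjI[OF C] allI impI)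
    fix f assume f: "Lp_fun p f"
    define T where "T l = (2 * l + 1) powr (5 * p - 8) * norm (fourier f l) powr p" for l
    define t where "t n = real n powr (5 * p - 8) * (norm (conj_haar.coef f n) / real n) powr p" for n
    have T: "T (real k / 2) = t (Suc k)" for k
      by (simp add: T_def t_def fourier_eq_coef norm_divide add.commute del: of_nat_Suc)
        (simp add: add.commute)
    have T0: "0 \<le> T l" for l by (simp add: T_def)
    have "0 \<le> (LINT x|conj_haar. norm (f x) powr p)"
      by (intro Bochner_Integration.integral_nonneg) simp
    then have norm: "Lp_norm p f powr p = (LINT x|conj_haar. norm (f x) powr p)"
      using assms by (simp add: Lp_norm_def powr_powr)
    have fin: "sum T K \<le> C * Lp_norm p f powr p" if K: "finite K" "K \<subseteq> half_nats" for K
    proof -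
      \<comment> \<open>A finite set of half-integers \<open>k / 2\<close> corresponds to the
        frequencies \<open>Suc k\<close>, which are never 0. Uniform bounds on finite sums give both
        summability and the estimate, since all terms are nonnegative.\<close>
      obtain I where I: "K = (\<lambda>k. real k / 2) ` I" "finite I" "inj_on (\<lambda>k. real k / 2) I"
        using K unfolding half_nats_def subset_image_inj by (metis finite_imageD)
      have "sum T K = sum t (Suc ` I)"
        using I by (simp add: sum.reindex T)
      also have "\<dots> \<le> C * (LINT x|conj_haar. norm (f x) powr p)"
        unfolding t_def using f I by (intro bound) (auto simp: Lp_fun_def)
      finally show ?thesis by (simp only: norm)
    qed
    have "T summable_on half_nats"
      using fin T0 by (intro nonneg_bdd_above_summable_on) (auto intro!: bdd_aboveI2)
    moreover have "infsum T half_nats \<le> C * Lp_norm p f powr p"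
      using calculation fin by (intro infsum_le_finite_sums) auto
    ultimately show "(\<lambda>l. (2 * l + 1) powr (5 * p - 8) * norm (fourier f l) powr p) summable_on half_nats \<and>
      (\<Sum>\<^sub>\<infinity>l\<in>half_nats. (2 * l + 1) powr (5 * p - 8) * norm (fourier f l) powr p)
        \<le> C * Lp_norm p f powr p"
      unfolding T_def by blast
  qed
qed

end
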